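(* There is an absolute constant $C>0$ such that, for every polynomial $F:\mathbb{C}\to\mathbb{C}$ (a polynomial in $z$ with complex coefficients), \[ \|F^2-F(0)^2\|_{\mathcal{F}^2(\mathbb{C})} \leq C\inf_{c\in\mathbb{R}}\||F|^2-c\|_{\mathcal{F}^2(\mathbb{C})}. \] The same estimate holds for every entire function $F:\mathbb{C}\to\mathbb{C}$ such that $F^2\in\mathcal{F}^2(\mathbb{C})$.
   Context: Let $m$ denote Lebesgue measure on $\mathbb{C}\cong\mathbb{R}^2$ and let $\gamma$ be the Gaussian probability measure on $\mathbb{C}$ given by $\mathrm{d}\gamma(z)=\frac{1}{\pi}e^{-|z|^2}\,\mathrm{d}m(z)$. For a measurable function $H:\mathbb{C}\to\mathbb{C}$ (not necessarily holomorphic) write $\|H\|_{\mathcal{F}^2(\mathbb{C})}^2:=\int_{\mathbb{C}}|H(z)|^2\,\mathrm{d}\gamma(z)$. The Fock space $\mathcal{F}^2(\mathbb{C})$ is the space of entire functions $H$ with $\|H\|_{\mathcal{F}^2(\mathbb{C})}<\infty$. Here $F^2$ is the pointwise square $z\mapsto F(z)^2$. "Absolute constant" means that $C$ does not depend on $F$. *)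

theory Defs
  imports "HOL-Analysis.Analysis" "HOL-Computational_Algebra.Polynomial"
begin

definition gauss_measure :: "complex measure" where
  "gauss_measure = density lborel (\<lambda>z. ennreal (1 / pi * exp (- (cmod z)\<^sup>2)))"

text \<open>
  The norm takes values in \<^typ>\<open>ennreal\<close>, so that a function that is not square integrable has
  norm \<open>\<infinity>\<close> (with a real-valued Bochner integral it would get norm \<open>0\<close>).
  The library has no square root on \<^typ>\<open>ennreal\<close>.
\<close>
definition ennreal_sqrt :: "ennreal \<Rightarrow> ennreal" where
  "ennreal_sqrt x = (if x = \<infinity> then \<infinity> else ennreal (sqrt (enn2real x)))"

definition fock_norm :: "(complex \<Rightarrow> complex) \<Rightarrow> ennreal" where
  "fock_norm H = ennreal_sqrt (\<integral>\<^sup>+ z. ennreal ((cmod (H z))\<^sup>2) \<partial>gauss_measure)"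

definition fock_space :: "(complex \<Rightarrow> complex) set" where
  "fock_space = {H. H holomorphic_on UNIV \<and> fock_norm H < \<infinity>}"

end

theory Submission
  imports Defs "HOL-Complex_Analysis.Conformal_Mappings" "HOL-Real_Asymp.Real_Asymp"
begin

text \<open>
  Put \<open>G = F\<^sup>2\<close>, so that \<open>\<bar>F\<bar>\<^sup>2 = \<bar>G\<bar>\<close>. The theorem is then a statement about an entire function
  \<open>G\<close>: if \<open>\<bar>G\<bar>\<close> is close to a constant \<open>c\<close> in the Gaussian \<open>L\<^sup>2\<close> norm, then \<open>G\<close> is close to
  \<open>G 0\<close>. The proof combines a local estimate, in which no Gaussian appears, with a Hardy inequality.

  Locally, a holomorphic function whose modulus is nearly constant is nearly constant itself:
  \<open>R\<^sup>4 \<bar>G' z\<bar>\<^sup>2\<close> is at most a constant times the integral of \<open>(\<bar>G\<bar> - c)\<^sup>2\<close> over the disc of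
  radius \<open>R\<close> about \<open>z\<close> (\<open>deriv_sq_le_L2_deviation\<close>). Indeed, \<open>\<bar>G\<bar>\<close> is subharmonic, so its
  mean deviation from \<open>c\<close> bounds it from above on a smaller disc; the same deviation shows that this
  upper bound is nearly attained at some point; and a holomorphic function that nearly attains an upper
  bound for its modulus is nearly constant around that point, by the Schwarz lemma.

  Globally, \<open>G z - G 0\<close> is the integral of \<open>G'\<close> along a ray. Because the Gaussian decays at the
  scale \<open>1 / \<bar>z\<bar>\<close>, the Gaussian \<open>L\<^sup>2\<close> norm of such ray integrals is bounded by that of
  \<open>G' w / \<bar>w\<bar>\<close> (\<open>gaussian_hardy_along_rays\<close>), where a neighbourhood of the origin is treated
  separately. Inserting the local estimate with \<open>R = 1 / \<bar>w\<bar>\<close> costs a factor \<open>\<bar>w\<bar>\<^sup>2\<close>, which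
  is the inverse of the area of the discs up to a constant, so that each point is
  counted a bounded number of times, and the Gaussian is constant on such a disc up to a factor. This
  gives \<open>gaussian_oscillation_le_modulus_deviation\<close> for every real \<open>c\<close> with the same constant.
\<close>

section \<open>Area means over discs\<close>

lemma ball_in_sets_borel [measurable]: "ball (a :: 'a::metric_space) r \<in> sets borel"
  by simp

lemma nn_integral_lborel_shift:
  fixes f :: "'a::euclidean_space \<Rightarrow> ennreal"
  assumes [measurable]: "f \<in> borel_measurable borel"
  shows "(\<integral>\<^sup>+x. f (a + x) \<partial>lborel) = (\<integral>\<^sup>+x. f x \<partial>lborel)"
  by (subst (2) lborel_distr_plus[of a, symmetric], subst nn_integral_distr) auto

text \<open>
  This is the uniqueness argument for Haar measure. Integrating \<open>f (T x)\<close> times the indicator of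
  the unit ball at \<open>y - T x\<close> over both variables, in the two possible orders and after a translation
  by a preimage of \<open>y\<close>, compares both sides multiplied by the volume of the unit ball, since that
  ball is preserved by \<open>T\<close>.
\<close>

lemma nn_integral_lborel_isometry:
  fixes f :: "'a::euclidean_space \<Rightarrow> ennreal" and T :: "'a \<Rightarrow> 'a"
  assumes [measurable]: "f \<in> borel_measurable borel"
    and T: "linear T" "\<And>x. norm (T x) = norm x"
  shows "(\<integral>\<^sup>+x. f (T x) \<partial>lborel) = (\<integral>\<^sup>+x. f x \<partial>lborel)"
proof -
  have "continuous_on UNIV T"
    using T(1) by (simp add: linear_continuous_on linear_linear)
  then have [measurable]: "T \<in> borel_measurable borel"
    by (rule borel_measurable_continuous_onI)
  have "inj T"
    using T by (metis linear_injective_0 norm_eq_zero)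
  then have "surj T"
    by (intro linear_injective_imp_surjective[OF T(1)]) auto
  define B where "B = (ball 0 1 :: 'a set)"
  have [measurable]: "B \<in> sets borel"
    by (simp add: B_def)
  have neg: "(- x \<in> B) = (x \<in> B)" and TB: "(T x \<in> B) = (x \<in> B)" for x
    by (auto simp: B_def T(2))
  have inner: "(\<integral>\<^sup>+x. f (T x) * indicator B (y - T x) \<partial>lborel)
      = (\<integral>\<^sup>+x. f (y + T x) * indicator B x \<partial>lborel)" for y
  proof -
    obtain y' where y': "y = T y'"
      using \<open>surj T\<close> by (metis surjD)
    have "(\<integral>\<^sup>+x. f (T x) * indicator B (y - T x) \<partial>lborel)
        = (\<integral>\<^sup>+x. f (T (y' + x)) * indicator B (y - T (y' + x)) \<partial>lborel)"
      by (rule nn_integral_lborel_shift[symmetric]) measurable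
    also have "\<dots> = (\<integral>\<^sup>+x. f (y + T x) * indicator B x \<partial>lborel)"
      by (intro nn_integral_cong) (simp add: y' linear_add[OF T(1)] indicator_def neg TB)
    finally show ?thesis .
  qed
  have shift: "(\<integral>\<^sup>+y. indicator B (y - a) \<partial>lborel) = emeasure lborel B" for a :: 'a
    using nn_integral_lborel_shift[of "indicator B" "- a"] by simp
  have "(\<integral>\<^sup>+x. f (T x) \<partial>lborel) * emeasure lborel B
      = (\<integral>\<^sup>+x. f (T x) * (\<integral>\<^sup>+y. indicator B (y - T x) \<partial>lborel) \<partial>lborel)"
    by (simp add: shift nn_integral_multc)
  also have "\<dots> = (\<integral>\<^sup>+x. (\<integral>\<^sup>+y. f (T x) * indicator B (y - T x) \<partial>lborel) \<partial>lborel)"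
    by (simp add: nn_integral_cmult)
  also have "\<dots> = (\<integral>\<^sup>+y. (\<integral>\<^sup>+x. f (T x) * indicator B (y - T x) \<partial>lborel) \<partial>lborel)"
    by (rule lborel_pair.Fubini') measurable
  also have "\<dots> = (\<integral>\<^sup>+y. (\<integral>\<^sup>+x. f (y + T x) * indicator B x \<partial>lborel) \<partial>lborel)"
    by (simp only: inner)
  also have "\<dots> = (\<integral>\<^sup>+x. (\<integral>\<^sup>+y. f (y + T x) * indicator B x \<partial>lborel) \<partial>lborel)"
    by (rule lborel_pair.Fubini') measurable
  also have "\<dots> = (\<integral>\<^sup>+x. (\<integral>\<^sup>+y. f (T x + y) \<partial>lborel) * indicator B x \<partial>lborel)"
    by (simp add: nn_integral_multc add.commute)
  also have "\<dots> = (\<integral>\<^sup>+x. f x \<partial>lborel) * emeasure lborel B"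
    by (simp add: nn_integral_lborel_shift nn_integral_cmult)
  finally have eq: "(\<integral>\<^sup>+x. f (T x) \<partial>lborel) * emeasure lborel B
      = (\<integral>\<^sup>+x. f x \<partial>lborel) * emeasure lborel B" .
  have "emeasure lborel B \<noteq> 0" "emeasure lborel B \<noteq> \<infinity>"
    by (simp_all add: B_def emeasure_ball unit_ball_vol_pos less_imp_neq[symmetric])
  with eq show ?thesis
    by (metis ennreal_mult_divide_eq infinity_ennreal_def)
qed

lemma emeasure_lborel_ball_complex:
  fixes z :: complex
  assumes "r \<ge> 0"
  shows "emeasure lborel (ball z r) = ennreal (pi * r\<^sup>2)"
  using emeasure_ball[of r z] assms by (simp add: unit_ball_vol_2)

text \<open>
  The circle is parametrised from the given point \<open>z + w\<close>, not from the real direction, so that the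
  mean can later be exchanged with an integral over \<open>w\<close>.
\<close>

lemma entire_norm_le_circle_mean:
  assumes "G holomorphic_on UNIV"
  shows "ennreal (cmod (G z))
    \<le> (\<integral>\<^sup>+t\<in>{0..1}. ennreal (cmod (G (z + exp (2 * of_real pi * \<i> * of_real t) * w))) \<partial>lborel)"
proof -
  define e where "e t = exp (2 * of_real pi * \<i> * of_real t)" for t :: real
  define h where "h \<zeta> = G (z + \<zeta> * w)" for \<zeta>
  have "(\<lambda>\<zeta>. z + \<zeta> * w) holomorphic_on UNIV"
    by (intro holomorphic_intros)
  then have "(G \<circ> (\<lambda>\<zeta>. z + \<zeta> * w)) holomorphic_on UNIV"
    by (rule holomorphic_on_compose_gen[OF _ assms]) auto
  then have h: "h holomorphic_on UNIV"
    unfolding h_def o_def .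
  have "((\<lambda>u. h u / (u - 0)) has_contour_integral (2 * of_real pi * \<i> * h 0)) (circlepath 0 1)"
    using h by (intro Cauchy_integral_circlepath_simple) (auto intro: holomorphic_on_subset)
  then have "((\<lambda>t. h (e t) / e t * (2 * pi * \<i> * e t)) has_integral (2 * of_real pi * \<i> * h 0)) {0..1}"
    unfolding has_contour_integral_def
    by (rule has_integral_eq[rotated]) (simp add: vector_derivative_circlepath01, simp add: circlepath e_def)
  then have "((\<lambda>t. (2 * pi * \<i>) * h (e t)) has_integral (2 * of_real pi * \<i>) * h 0) {0..1}"
    by (rule has_integral_eq[rotated]) (simp add: e_def field_simps)
  from has_integral_mult_right[OF this, of "1 / (2 * of_real pi * \<i>)"]
  have mean: "((\<lambda>t. h (e t)) has_integral h 0) {0..1}"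
    by simp
  have cont: "continuous_on {0..1} (\<lambda>t. h (e t))"
    unfolding e_def
    by (intro continuous_on_compose2[OF holomorphic_on_imp_continuous_on[OF h]] continuous_intros) auto
  have int: "set_integrable lborel {0..1} (\<lambda>t. h (e t))"
    by (rule borel_integrable_atLeastAtMost'[OF cont])
  have "h 0 = (LINT t:{0..1}|lborel. h (e t))"
    using set_borel_integral_eq_integral(2)[OF int] mean by (simp add: integral_unique)
  then have "ennreal (norm (h 0)) \<le> (\<integral>\<^sup>+t. ennreal (norm (indicator {0..1} t *\<^sub>R h (e t))) \<partial>lborel)"
    unfolding set_lebesgue_integral_def
    using integral_norm_bound_ennreal[OF int[unfolded set_integrable_def]] by simp
  also have "\<dots> = (\<integral>\<^sup>+t\<in>{0..1}. ennreal (norm (h (e t))) \<partial>lborel)"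
    by (intro nn_integral_cong) (auto simp: indicator_def)
  finally show ?thesis
    by (simp add: h_def e_def)
qed

text \<open>
  Averaging the rotation-invariant integral over a disc over all rotations turns it into an integral
  of circle means, each of which dominates the value at the centre. This avoids polar coordinates.
\<close>

lemma entire_area_submean:
  assumes G: "G holomorphic_on UNIV" and "r \<ge> 0"
  shows "ennreal (pi * r\<^sup>2 * cmod (G z)) \<le> (\<integral>\<^sup>+w\<in>ball z r. ennreal (cmod (G w)) \<partial>lborel)"
proof -
  have [measurable]: "G \<in> borel_measurable borel"
    using G by (intro borel_measurable_continuous_onI holomorphic_on_imp_continuous_on)
  define e where "e t = exp (2 * of_real pi * \<i> * of_real t)" for t :: real
  have [measurable]: "e \<in> borel_measurable borel"
    unfolding e_def by (intro borel_measurable_continuous_onI continuous_intros)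
  have norm_e: "norm (e t * w) = norm w" for t w
    by (simp add: e_def norm_mult)
  have rot: "(\<integral>\<^sup>+w. ennreal (cmod (G (z + e t * w))) * indicator (ball 0 r) w \<partial>lborel)
      = (\<integral>\<^sup>+w\<in>ball z r. ennreal (cmod (G w)) \<partial>lborel)" for t
  proof -
    have "(\<integral>\<^sup>+w. ennreal (cmod (G (z + e t * w))) * indicator (ball 0 r) w \<partial>lborel)
       = (\<integral>\<^sup>+w. ennreal (cmod (G (z + e t * w))) * indicator (ball 0 r) (e t * w) \<partial>lborel)"
      by (intro nn_integral_cong) (auto simp: indicator_def norm_e)
    also have "\<dots> = (\<integral>\<^sup>+w. ennreal (cmod (G (z + w))) * indicator (ball 0 r) w \<partial>lborel)"
    proof (rule nn_integral_lborel_isometry[where T="\<lambda>w. e t * w" and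
          f="\<lambda>w. ennreal (cmod (G (z + w))) * indicator (ball 0 r) w"])
      show "(\<lambda>w. ennreal (cmod (G (z + w))) * indicator (ball 0 r) w) \<in> borel_measurable borel"
        by measurable
    qed (auto simp: norm_e intro: bounded_linear.linear[OF bounded_linear_mult_right])
    also have "\<dots> = (\<integral>\<^sup>+w. ennreal (cmod (G (z + w))) * indicator (ball z r) (z + w) \<partial>lborel)"
      by (intro nn_integral_cong) (auto simp: indicator_def dist_norm)
    also have "\<dots> = (\<integral>\<^sup>+w\<in>ball z r. ennreal (cmod (G w)) \<partial>lborel)"
      by (rule nn_integral_lborel_shift[where f="\<lambda>w. ennreal (cmod (G w)) * indicator (ball z r) w"]) measurable
    finally show ?thesis .
  qed
  have "ennreal (pi * r\<^sup>2 * cmod (G z)) = (\<integral>\<^sup>+(w::complex). ennreal (cmod (G z)) * indicator (ball 0 r) w \<partial>lborel)"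
    using \<open>r \<ge> 0\<close>
    by (simp add: nn_integral_cmult_indicator emeasure_lborel_ball_complex mult.commute[of _ "cmod (G z)"] ennreal_mult)
  also have "\<dots> \<le> (\<integral>\<^sup>+w. (\<integral>\<^sup>+t. ennreal (cmod (G (z + e t * w))) * indicator {0..1} t \<partial>lborel) * indicator (ball 0 r) w \<partial>lborel)"
    using entire_norm_le_circle_mean[OF G]
    by (intro nn_integral_mono mult_right_mono) (auto simp: e_def)
  also have "\<dots> = (\<integral>\<^sup>+w. (\<integral>\<^sup>+t. ennreal (cmod (G (z + e t * w))) * indicator {0..1} t * indicator (ball 0 r) w \<partial>lborel) \<partial>lborel)"
    by (simp add: nn_integral_multc)
  also have "\<dots> = (\<integral>\<^sup>+t. (\<integral>\<^sup>+w. ennreal (cmod (G (z + e t * w))) * indicator {0..1} t * indicator (ball 0 r) w \<partial>lborel) \<partial>lborel)"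
    by (rule lborel_pair.Fubini') measurable
  also have "\<dots> = (\<integral>\<^sup>+(t::real). indicator {0..1} t * (\<integral>\<^sup>+w. ennreal (cmod (G (z + e t * w))) * indicator (ball 0 r) w \<partial>lborel) \<partial>lborel)"
    by (simp add: nn_integral_cmult[symmetric] mult_ac)
  also have "\<dots> = (\<integral>\<^sup>+w\<in>ball z r. ennreal (cmod (G w)) \<partial>lborel)"
    by (simp add: rot nn_integral_multc)
  finally show ?thesis .
qed

section \<open>The local estimate\<close>

text \<open>
  The constant \<open>c\<close> is its own mean, so the mean value inequality for \<open>\<bar>G\<bar>\<close> is one for
  \<open>\<bar>G\<bar> - c\<close>. The passage to the quadratic mean is the inequality of arithmetic and geometric
  means, weighted by \<open>\<delta>\<close>.
\<close>

lemma entire_norm_le_of_L2_deviation: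
  assumes G: "G holomorphic_on UNIV" and "r > 0" "c \<ge> 0" "\<delta> > 0"
    and dev: "(\<integral>\<^sup>+w\<in>ball z r. ennreal ((cmod (G w) - c)\<^sup>2) \<partial>lborel) \<le> ennreal (pi * r\<^sup>2 * \<delta>\<^sup>2)"
  shows "cmod (G z) \<le> c + \<delta>"
proof -
  have [measurable]: "G \<in> borel_measurable borel"
    using G by (intro borel_measurable_continuous_onI holomorphic_on_imp_continuous_on)
  have pt: "x \<le> (c + \<delta> / 2) + (x - c)\<^sup>2 * (1 / (2 * \<delta>))" for x
  proof -
    have "0 \<le> (x - c - \<delta>)\<^sup>2 / (2 * \<delta>)"
      using \<open>\<delta> > 0\<close> by simp
    also have "\<dots> = (c + \<delta> / 2) + (x - c)\<^sup>2 * (1 / (2 * \<delta>)) - x"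
      using \<open>\<delta> > 0\<close> by (simp add: field_simps power2_eq_square)
    finally show ?thesis by simp
  qed
  have "ennreal (pi * r\<^sup>2 * cmod (G z)) \<le> (\<integral>\<^sup>+w\<in>ball z r. ennreal (cmod (G w)) \<partial>lborel)"
    using entire_area_submean[OF G] \<open>r > 0\<close> by simp
  also have "\<dots> \<le> (\<integral>\<^sup>+w. ennreal (c + \<delta> / 2) * indicator (ball z r) w 
      + (ennreal ((cmod (G w) - c)\<^sup>2) * indicator (ball z r) w) * ennreal (1 / (2 * \<delta>)) \<partial>lborel)"
    using pt assms
    by (intro nn_integral_mono)
      (auto simp: indicator_def ennreal_mult'[symmetric] ennreal_plus[symmetric] simp del: ennreal_plus intro!: ennreal_leI)
  also have "\<dots> = (\<integral>\<^sup>+w. ennreal (c + \<delta> / 2) * indicator (ball z r) w \<partial>lborel)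
      + (\<integral>\<^sup>+w. (ennreal ((cmod (G w) - c)\<^sup>2) * indicator (ball z r) w) * ennreal (1 / (2 * \<delta>)) \<partial>lborel)"
    by (rule nn_integral_add) measurable
  also have "\<dots> = ennreal (c + \<delta> / 2) * ennreal (pi * r\<^sup>2)
      + (\<integral>\<^sup>+w\<in>ball z r. ennreal ((cmod (G w) - c)\<^sup>2) \<partial>lborel) * ennreal (1 / (2 * \<delta>))"
    using \<open>r > 0\<close>
    by (simp add: nn_integral_multc nn_integral_cmult_indicator emeasure_lborel_ball_complex)
  also have "\<dots> \<le> ennreal (c + \<delta> / 2) * ennreal (pi * r\<^sup>2)
      + ennreal (pi * r\<^sup>2 * \<delta>\<^sup>2) * ennreal (1 / (2 * \<delta>))"
    by (intro add_left_mono mult_right_mono dev) auto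
  also have "\<dots> = ennreal (pi * r\<^sup>2 * (c + \<delta>))"
    using assms by (simp add: ennreal_mult'[symmetric] ennreal_plus[symmetric] field_simps power2_eq_square del: ennreal_plus)
  finally have "pi * r\<^sup>2 * cmod (G z) \<le> pi * r\<^sup>2 * (c + \<delta>)"
    using assms by (simp add: ennreal_le_iff)
  then show ?thesis
    using \<open>r > 0\<close> by (simp add: mult_le_cancel_left_pos)
qed

text \<open>
  A minimum point of the deviation on the closed disc does at least as well as the mean.
\<close>

lemma exists_point_norm_near:
  fixes G :: "complex \<Rightarrow> complex"
  assumes G: "continuous_on UNIV G" and "s > 0" "\<delta> > 0"
    and dev: "(\<integral>\<^sup>+w\<in>ball z s. ennreal ((cmod (G w) - c)\<^sup>2) \<partial>lborel) \<le> ennreal (pi * s\<^sup>2 * \<delta>\<^sup>2)"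
  obtains p where "dist z p \<le> s" "\<bar>cmod (G p) - c\<bar> \<le> \<delta>"
proof -
  have "continuous_on (cball z s) (\<lambda>w. (cmod (G w) - c)\<^sup>2)"
    using G by (intro continuous_intros) (auto intro: continuous_on_subset)
  then obtain p where p: "p \<in> cball z s" 
    and min: "\<And>w. w \<in> cball z s \<Longrightarrow> (cmod (G p) - c)\<^sup>2 \<le> (cmod (G w) - c)\<^sup>2"
    using continuous_attains_inf[of "cball z s" "\<lambda>w. (cmod (G w) - c)\<^sup>2"] \<open>s > 0\<close> by auto
  have "ennreal ((cmod (G p) - c)\<^sup>2 * (pi * s\<^sup>2)) 
      = (\<integral>\<^sup>+w. ennreal ((cmod (G p) - c)\<^sup>2) * indicator (ball z s) w \<partial>lborel)"
    using \<open>s > 0\<close> by (simp add: nn_integral_cmult_indicator emeasure_lborel_ball_complex ennreal_mult)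
  also have "\<dots> \<le> (\<integral>\<^sup>+w\<in>ball z s. ennreal ((cmod (G w) - c)\<^sup>2) \<partial>lborel)"
    using min by (intro nn_integral_mono) (auto simp: indicator_def intro!: ennreal_leI)
  also note dev
  finally have "(cmod (G p) - c)\<^sup>2 * (pi * s\<^sup>2) \<le> \<delta>\<^sup>2 * (pi * s\<^sup>2)"
    by (simp add: mult_ac ennreal_le_iff)
  then have "(cmod (G p) - c)\<^sup>2 \<le> \<delta>\<^sup>2"
    using \<open>s > 0\<close> by (simp add: mult_le_cancel_right_pos)
  then have "\<bar>cmod (G p) - c\<bar> \<le> \<delta>"
    using \<open>\<delta> > 0\<close> by (simp add: abs_le_square_iff[symmetric])
  with p show ?thesis
    by (intro that) auto
qed

text \<open>
  A quantitative Harnack inequality. The Cayley transform \<open>(f - b) / (f + b)\<close> maps the disc to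
  the unit disc and vanishes at the centre \<open>p\<close>, so by the Schwarz lemma it stays away from \<open>1\<close> on
  smaller concentric discs; there \<open>f\<close> is bounded by a multiple of \<open>b\<close>, and Cauchy's inequality
  on a disc around \<open>z0\<close> bounds the derivative.
\<close>

lemma deriv_bound_Re_pos:
  assumes f: "f holomorphic_on ball p \<rho>" and "\<rho> > 0"
    and pos: "\<And>z. z \<in> ball p \<rho> \<Longrightarrow> Re (f z) > 0"
    and fp: "f p = of_real b"
    and z0: "dist p z0 \<le> \<rho> / 3"
  shows "cmod (deriv f z0) \<le> 16 * b / \<rho>"
proof -
  have "b > 0"
    using pos[of p] fp \<open>\<rho> > 0\<close> by simp
  define \<phi> where "\<phi> z = (f z - b) / (f z + b)" for z
  have nz: "f z + b \<noteq> 0" if "z \<in> ball p \<rho>" for z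
  proof
    assume "f z + b = 0"
    then have "Re (f z + b) = 0" by simp
    with pos[OF that] \<open>b > 0\<close> show False by simp
  qed
  have lt1: "cmod (\<phi> z) < 1" if "z \<in> ball p \<rho>" for z
  proof -
    have "(cmod (f z - b))\<^sup>2 < (cmod (f z + b))\<^sup>2"
      using mult_pos_pos[OF pos[OF that] \<open>b > 0\<close>]
      unfolding cmod_power2 by (simp add: power2_eq_square algebra_simps)
    then have "cmod (f z - b) < cmod (f z + b)"
      by (rule power2_less_imp_less) simp
    then show ?thesis
      using nz[OF that] by (simp add: \<phi>_def norm_divide)
  qed
  define \<psi> where "\<psi> u = \<phi> (p + of_real \<rho> * u)" for u
  have inb: "p + of_real \<rho> * u \<in> ball p \<rho>" if "norm u < 1" for u
    using that \<open>\<rho> > 0\<close> by (simp add: dist_norm norm_mult)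
  have "\<phi> holomorphic_on ball p \<rho>"
    unfolding \<phi>_def using nz by (intro holomorphic_intros f) auto
  then have "\<psi> holomorphic_on ball 0 1"
    unfolding \<psi>_def using inb
    by (intro holomorphic_on_compose_gen[of "\<lambda>u. p + of_real \<rho> * u" "ball 0 1" \<phi> "ball p \<rho>", unfolded o_def])
      (auto intro!: holomorphic_intros)
  then have schwarz: "cmod (\<psi> u) \<le> cmod u" if "cmod u < 1" for u
  proof (rule Schwarz_Lemma(1)[of \<psi>])
    show "\<psi> 0 = 0"
      by (simp add: \<psi>_def \<phi>_def fp)
    show "cmod (\<psi> z) < 1" if "cmod z < 1" for z
      unfolding \<psi>_def using that by (intro lt1 inb)
  qed (fact+)
  \<comment> \<open>A disc of radius \<open>\<rho> / 4\<close> around \<open>z0\<close> lies within distance \<open>\<rho> / 3 + \<rho> / 4\<close> of \<open>p\<close>.\<close>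
  have bound: "cmod (f z) \<le> 4 * b" if "dist p z \<le> 7 / 12 * \<rho>" for z
  proof -
    have zb: "z \<in> ball p \<rho>"
      using that \<open>\<rho> > 0\<close> by simp
    have small: "cmod ((z - p) / of_real \<rho>) \<le> 7 / 12"
      using that \<open>\<rho> > 0\<close> by (simp add: norm_divide dist_norm norm_minus_commute field_simps)
    have "cmod (\<phi> z) \<le> cmod ((z - p) / of_real \<rho>)"
      using schwarz[of "(z - p) / of_real \<rho>"] small \<open>\<rho> > 0\<close> by (simp add: \<psi>_def)
    with small have "cmod (\<phi> z) \<le> 7 / 12"
      by linarith
    then have "cmod (f z - b) \<le> 7 / 12 * cmod (f z + b)"
      using nz[OF zb] by (simp add: \<phi>_def norm_divide field_simps)
    moreover have "cmod (f z + b) \<le> cmod (f z) + b"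
      using norm_triangle_ineq[of "f z" "of_real b"] \<open>b > 0\<close> by simp
    moreover have "cmod (f z) \<le> cmod (f z - b) + b"
      using norm_triangle_ineq[of "f z - of_real b" "of_real b"] \<open>b > 0\<close> by simp
    ultimately show ?thesis
      using \<open>b > 0\<close> by simp
  qed
  have sub: "cball z0 (\<rho> / 4) \<subseteq> ball p \<rho>"
  proof
    fix x assume "x \<in> cball z0 (\<rho> / 4)"
    with z0 dist_triangle[of p x z0] \<open>\<rho> > 0\<close> show "x \<in> ball p \<rho>" by simp
  qed
  have "norm ((deriv ^^ 1) f z0) \<le> fact 1 * (4 * b) / (\<rho> / 4) ^ 1"
  proof (rule Cauchy_inequality)
    show "f holomorphic_on ball z0 (\<rho> / 4)"
      using sub by (intro holomorphic_on_subset[OF f]) (meson ball_subset_cball order_trans)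
    show "continuous_on (cball z0 (\<rho> / 4)) f"
      using sub by (intro continuous_on_subset[OF holomorphic_on_imp_continuous_on[OF f]])
    show "cmod (f x) \<le> 4 * b" if "cmod (z0 - x) = \<rho> / 4" for x
      using z0 dist_triangle[of p x z0] that by (intro bound) (simp add: dist_norm)
  qed (use \<open>\<rho> > 0\<close> in auto)
  then show ?thesis by simp
qed

text \<open>
  The mean value inequality bounds \<open>\<bar>G\<bar>\<close> from above by \<open>c + O(\<delta>)\<close> on a whole disc, while at some
  nearby point \<open>p\<close> it is at least \<open>c - O(\<delta>)\<close>. After a rotation making \<open>G p\<close> nonnegative, the
  function \<open>c + 3 * \<delta> - G\<close> has positive real part and value \<open>O(\<delta>)\<close> at \<open>p\<close>, hence derivative
  \<open>O(\<delta> / R)\<close> by the Harnack-type bound.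
\<close>

lemma deriv_bound_of_L2_deviation:
  assumes G: "G holomorphic_on UNIV" and "R > 0" "c \<ge> 0" "\<delta> > 0"
    and dev: "(\<integral>\<^sup>+w\<in>ball z R. ennreal ((cmod (G w) - c)\<^sup>2) \<partial>lborel) \<le> ennreal (R\<^sup>2 * \<delta>\<^sup>2)"
  shows "cmod (deriv G z) \<le> 500 * \<delta> / R"
proof -
  \<comment> \<open>The mean square deviation on a smaller disc grows at most like the inverse ratio of the areas.\<close>
  have dev_sub: "(\<integral>\<^sup>+w\<in>ball x s. ennreal ((cmod (G w) - c)\<^sup>2) \<partial>lborel) \<le> ennreal (pi * s\<^sup>2 * \<epsilon>\<^sup>2)"
    if "ball x s \<subseteq> ball z R" "s * \<epsilon> = R * \<delta>" for x s \<epsilon>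
  proof -
    have "(\<integral>\<^sup>+w\<in>ball x s. ennreal ((cmod (G w) - c)\<^sup>2) \<partial>lborel)
        \<le> (\<integral>\<^sup>+w\<in>ball z R. ennreal ((cmod (G w) - c)\<^sup>2) \<partial>lborel)"
      using that(1) by (intro nn_integral_mono) (auto simp: indicator_def)
    also note dev
    also have "ennreal (R\<^sup>2 * \<delta>\<^sup>2) \<le> ennreal (pi * s\<^sup>2 * \<epsilon>\<^sup>2)"
    proof (rule ennreal_leI)
      have "R\<^sup>2 * \<delta>\<^sup>2 = s\<^sup>2 * \<epsilon>\<^sup>2"
        using that(2) by (metis power_mult_distrib)
      also have "\<dots> \<le> pi * (s\<^sup>2 * \<epsilon>\<^sup>2)"
        using mult_right_mono[of 1 pi "s\<^sup>2 * \<epsilon>\<^sup>2"] pi_gt3 by simp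
      finally show "R\<^sup>2 * \<delta>\<^sup>2 \<le> pi * s\<^sup>2 * \<epsilon>\<^sup>2"
        by (simp add: mult.assoc)
    qed
    finally show ?thesis .
  qed
  have upper: "cmod (G x) \<le> c + 2 * \<delta>" if "dist z x < R / 2" for x
  proof (rule entire_norm_le_of_L2_deviation[OF G])
    have "ball x (R / 2) \<subseteq> ball z R"
      using that dist_triangle_lt[of z x] by (force simp: dist_commute)
    then show "(\<integral>\<^sup>+w\<in>ball x (R / 2). ennreal ((cmod (G w) - c)\<^sup>2) \<partial>lborel)
        \<le> ennreal (pi * (R / 2)\<^sup>2 * (2 * \<delta>)\<^sup>2)"
      by (rule dev_sub) simp
  qed (use assms in auto)
  have "(\<integral>\<^sup>+w\<in>ball z (R / 8). ennreal ((cmod (G w) - c)\<^sup>2) \<partial>lborel)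
      \<le> ennreal (pi * (R / 8)\<^sup>2 * (8 * \<delta>)\<^sup>2)"
    using \<open>R > 0\<close> by (intro dev_sub subset_ball) auto
  then obtain p where p: "dist z p \<le> R / 8" "\<bar>cmod (G p) - c\<bar> \<le> 8 * \<delta>"
    using exists_point_norm_near[of G "R / 8" "8 * \<delta>"] holomorphic_on_imp_continuous_on[OF G] assms
    by auto
  obtain a where a: "cmod a = 1" "a * G p = of_real (cmod (G p))"
  proof (cases "G p = 0")
    case False
    have "cnj (sgn (G p)) * G p = of_real (cmod (G p))"
      using False by (simp add: sgn_eq complex_norm_square[symmetric] field_simps power2_eq_square)
    with False show ?thesis
      by (intro that[of "cnj (sgn (G p))"]) (auto simp: norm_sgn)
  qed (use that[of 1] in auto)
  \<comment> \<open>\<open>3 * \<delta>\<close> instead of \<open>2 * \<delta>\<close> makes the real part strictly positive.\<close>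
  define f where "f w = of_real (c + 3 * \<delta>) - a * G w" for w
  have f_hol: "f holomorphic_on UNIV"
    unfolding f_def by (intro holomorphic_intros G)
  have "cmod (deriv f z) \<le> 16 * (c + 3 * \<delta> - cmod (G p)) / (3 * R / 8)"
  proof (rule deriv_bound_Re_pos)
    show "0 < Re (f w)" if "w \<in> ball p (3 * R / 8)" for w
    proof -
      have "dist z w < R / 2"
        using that p(1) dist_triangle[of z w p] by simp
      then have "cmod (a * G w) \<le> c + 2 * \<delta>"
        using upper by (simp add: norm_mult a)
      then show ?thesis
        using complex_Re_le_cmod[of "a * G w"] \<open>\<delta> > 0\<close> by (simp add: f_def)
    qed
    show "f p = of_real (c + 3 * \<delta> - cmod (G p))"
      by (simp add: f_def a)
  qed (use f_hol p \<open>R > 0\<close> in \<open>auto simp: dist_commute intro: holomorphic_on_subset\<close>)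
  also have "\<dots> \<le> 16 * (11 * \<delta>) / (3 * R / 8)"
    using p(2) \<open>R > 0\<close> by (intro divide_right_mono) auto
  also have "\<dots> \<le> 500 * \<delta> / R"
    using \<open>R > 0\<close> \<open>\<delta> > 0\<close> by (simp add: field_simps)
  also have "deriv f z = - a * deriv G z"
    using G unfolding f_def
    by (intro DERIV_imp_deriv) (auto intro!: derivative_eq_intros holomorphic_derivI[OF G])
  finally show ?thesis
    by (simp add: norm_mult a)
qed

text \<open>
  For negative \<open>c\<close> the deviation only decreases when \<open>c\<close> is replaced by \<open>0\<close>, which reduces
  this to the previous bound; the slack \<open>\<epsilon>\<close> covers the case of deviation zero.
\<close>

lemma deriv_sq_le_L2_deviation:
  fixes c :: real
  assumes G: "G holomorphic_on UNIV" and "R > 0"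
  shows "ennreal (R ^ 4 * (cmod (deriv G z))\<^sup>2)
    \<le> ennreal 250000 * (\<integral>\<^sup>+w\<in>ball z R. ennreal ((cmod (G w) - c)\<^sup>2) \<partial>lborel)"
proof -
  define E where "E = (\<integral>\<^sup>+w\<in>ball z R. ennreal ((cmod (G w) - c)\<^sup>2) \<partial>lborel)"
  show ?thesis
  proof (cases "E = \<infinity>")
    case True
    then show ?thesis by (simp add: E_def[symmetric] ennreal_mult_top)
  next
    case False
    then obtain e where e: "E = ennreal e" "e \<ge> 0"
      by (cases E) auto
    have "(x - max c 0)\<^sup>2 \<le> (x - c)\<^sup>2" if "x \<ge> 0" for x
      using that by (auto simp: max_def intro!: power_mono)
    then have E': "(\<integral>\<^sup>+w\<in>ball z R. ennreal ((cmod (G w) - max c 0)\<^sup>2) \<partial>lborel) \<le> ennreal e"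
      unfolding e(1)[symmetric] E_def
      by (intro nn_integral_mono mult_right_mono ennreal_leI) auto
    have "R\<^sup>2 * cmod (deriv G z) \<le> 500 * sqrt e + \<epsilon>" if "\<epsilon> > 0" for \<epsilon>
    proof -
      define \<delta> where "\<delta> = (sqrt e + \<epsilon> / 500) / R"
      have "\<delta> > 0"
        using that \<open>R > 0\<close> e(2) by (auto simp: \<delta>_def intro!: divide_pos_pos add_nonneg_pos)
      have "e = (sqrt e)\<^sup>2"
        using e(2) by simp
      also have "\<dots> \<le> (sqrt e + \<epsilon> / 500)\<^sup>2"
        using that e(2) by (intro power_mono) auto
      also have "\<dots> = R\<^sup>2 * \<delta>\<^sup>2"
        using \<open>R > 0\<close> by (simp add: \<delta>_def power_divide)
      finally have "cmod (deriv G z) \<le> 500 * \<delta> / R"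
        using E' \<open>R > 0\<close> \<open>\<delta> > 0\<close>
        by (intro deriv_bound_of_L2_deviation[OF G, where c = "max c 0"]) (auto intro: order_trans ennreal_leI)
      also have "\<dots> = (500 * sqrt e + \<epsilon>) / R\<^sup>2"
        using \<open>R > 0\<close> by (simp add: \<delta>_def field_simps power2_eq_square)
      finally show ?thesis
        using \<open>R > 0\<close> by (simp add: field_simps)
    qed
    then have "R\<^sup>2 * cmod (deriv G z) \<le> 500 * sqrt e"
      by (rule field_le_epsilon)
    then have "(R\<^sup>2 * cmod (deriv G z))\<^sup>2 \<le> (500 * sqrt e)\<^sup>2"
      by (intro power_mono) auto
    then have "R ^ 4 * (cmod (deriv G z))\<^sup>2 \<le> 250000 * e"
      using e(2) by (simp add: power_mult_distrib power_mult[symmetric])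
    then show ?thesis
      using e by (simp add: E_def[symmetric] ennreal_mult'[symmetric] ennreal_leI del: ennreal_numeral)
  qed
qed

section \<open>Gaussian integrals\<close>

text \<open>
  Layer-cake: \<open>exp (- a)\<close> is the integral of \<open>exp (- s)\<close> over \<open>s \<ge> a\<close>, and
  \<open>(cmod z)\<^sup>2 \<le> s\<close> describes a disc of area \<open>pi * s\<close>.
\<close>

lemma nn_integral_gaussian_le_pi:
  "(\<integral>\<^sup>+(z::complex). ennreal (exp (- (cmod z)\<^sup>2)) \<partial>lborel) \<le> ennreal pi"
proof -
  have layer: "(\<integral>\<^sup>+s. ennreal (exp (- s)) * indicator {a..} s \<partial>lborel) = ennreal (exp (- a))" for a :: real
  proof -
    have "(\<integral>\<^sup>+s. ennreal (exp (- s)) * indicator {a..} s \<partial>lborel) = ennreal (0 - (- exp (- a)))"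
    proof (rule nn_integral_FTC_atLeast)
      show "((\<lambda>s. - exp (- s)) \<longlongrightarrow> (0::real)) at_top"
        by real_asymp
    qed (auto intro!: derivative_eq_intros)
    then show ?thesis by simp
  qed
  have "(\<integral>\<^sup>+(z::complex). ennreal (exp (- (cmod z)\<^sup>2)) \<partial>lborel)
      = (\<integral>\<^sup>+(z::complex). (\<integral>\<^sup>+s. ennreal (exp (- s)) * indicator {0..} (s - (cmod z)\<^sup>2) \<partial>lborel) \<partial>lborel)"
    by (subst layer[symmetric]) (intro nn_integral_cong, simp add: indicator_def)
  also have "\<dots> = (\<integral>\<^sup>+s. (\<integral>\<^sup>+(z::complex). ennreal (exp (- s)) * indicator {0..} (s - (cmod z)\<^sup>2) \<partial>lborel) \<partial>lborel)"
    by (rule lborel_pair.Fubini') measurable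
  also have "\<dots> \<le> (\<integral>\<^sup>+s. ennreal (pi * s * exp (- s)) * indicator {0..} s \<partial>lborel)"
  proof (rule nn_integral_mono)
    fix s :: real
    have "(\<integral>\<^sup>+(z::complex). ennreal (exp (- s)) * indicator {0..} (s - (cmod z)\<^sup>2) \<partial>lborel)
        = ennreal (exp (- s)) * (\<integral>\<^sup>+(z::complex). indicator {0..} (s - (cmod z)\<^sup>2) \<partial>lborel)"
      by (rule nn_integral_cmult) measurable
    also have "\<dots> \<le> ennreal (pi * s * exp (- s)) * indicator {0..} s"
    proof (cases "s \<ge> 0")
      case True
      have "(\<integral>\<^sup>+(z::complex). indicator {0..} (s - (cmod z)\<^sup>2) \<partial>lborel)
          = (\<integral>\<^sup>+(z::complex). indicator (cball 0 (sqrt s)) z \<partial>lborel)"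
        using real_sqrt_le_iff[of "(cmod _)\<^sup>2" s] by (intro nn_integral_cong) (simp add: indicator_def)
      also have "\<dots> = ennreal (pi * s)"
        using True emeasure_cball[of "sqrt s" "0::complex"] by (simp add: unit_ball_vol_2)
      finally show ?thesis
        using True by (simp add: ennreal_mult'[symmetric] mult_ac)
    next
      case False
      then have "s - (cmod z)\<^sup>2 < 0" for z
        using zero_le_power2[of "cmod z"] by linarith
      then show ?thesis
        by (simp add: indicator_def not_le[symmetric])
    qed
    finally show "(\<integral>\<^sup>+(z::complex). ennreal (exp (- s)) * indicator {0..} (s - (cmod z)\<^sup>2) \<partial>lborel)
      \<le> ennreal (pi * s * exp (- s)) * indicator {0..} s" .
  qed
  also have "\<dots> = ennreal (0 - (- pi * (0 + 1) * exp (- 0)))"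
  proof (rule nn_integral_FTC_atLeast)
    show "((\<lambda>s. - pi * (s + 1) * exp (- s)) \<longlongrightarrow> (0::real)) at_top"
      by real_asymp
  qed (auto intro!: derivative_eq_intros simp: algebra_simps)
  finally show ?thesis by simp
qed

lemma nn_integral_lborel_scale:
  fixes f :: "complex \<Rightarrow> ennreal"
  assumes [measurable]: "f \<in> borel_measurable borel" and "t > 0"
  shows "(\<integral>\<^sup>+z. f (of_real t * z) \<partial>lborel) = ennreal (1 / t\<^sup>2) * (\<integral>\<^sup>+z. f z \<partial>lborel)"
proof -
  have "(\<integral>\<^sup>+z. f z \<partial>lborel) = ennreal (t\<^sup>2) * (\<integral>\<^sup>+z. f (of_real t * z) \<partial>lborel)"
    using \<open>t > 0\<close>
    by (subst lborel_affine[of t 0])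
      (simp_all add: nn_integral_density nn_integral_distr nn_integral_cmult scaleR_conv_of_real)
  then show ?thesis
    using \<open>t > 0\<close> by (simp add: mult.assoc[symmetric] ennreal_mult[symmetric])
qed

lemma nn_integral_inverse_cube_gaussian_le:
  assumes "a > 0"
  shows "(\<integral>\<^sup>+t\<in>{0<..1}. ennreal (exp (- a / (2 * t\<^sup>2)) / t ^ 3) \<partial>lborel) \<le> ennreal (exp (- a / 2) / a)"
proof -
  \<comment> \<open>The antiderivative of the integrand; it extends differentiably by \<open>0\<close> to the end point \<open>0\<close>.\<close>
  define F where "F t = (if t = 0 then 0 else exp (- a / (2 * t\<^sup>2)) / a)" for t :: real
  define f where "f t = exp (- a / (2 * t\<^sup>2)) / t ^ 3" for t :: real
  have F_small: "\<bar>F t / t\<bar> \<le> 2 / a\<^sup>2 * \<bar>t\<bar>" for t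
  proof (cases "t = 0")
    case False
    have "a / (2 * t\<^sup>2) \<le> exp (a / (2 * t\<^sup>2))"
      using exp_ge_add_one_self[of "a / (2 * t\<^sup>2)"] by linarith
    then have "exp (- a / (2 * t\<^sup>2)) \<le> 2 * t\<^sup>2 / a"
      using False \<open>a > 0\<close> by (simp add: exp_minus field_simps)
    then have "F t \<le> 2 * t\<^sup>2 / a\<^sup>2"
      using False \<open>a > 0\<close> by (simp add: F_def field_simps power2_eq_square)
    moreover have "F t \<ge> 0"
      using \<open>a > 0\<close> by (simp add: F_def)
    ultimately have "\<bar>F t\<bar> / \<bar>t\<bar> \<le> (2 * t\<^sup>2 / a\<^sup>2) / \<bar>t\<bar>"
      by (intro divide_right_mono) auto
    also have "\<dots> = 2 / a\<^sup>2 * (\<bar>t\<bar>\<^sup>2 / \<bar>t\<bar>)"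
      by simp
    also have "\<bar>t\<bar>\<^sup>2 / \<bar>t\<bar> = \<bar>t\<bar>"
      using False by (simp add: power2_eq_square del: abs_mult_self_eq)
    finally show ?thesis
      by simp
  qed (simp add: F_def)
  have deriv: "DERIV F t :> f t" if "t \<in> {0..1}" for t
  proof (cases "t = 0")
    case True
    have "((\<lambda>h. F h / h) \<longlongrightarrow> 0) (at 0)"
    proof (rule Lim_null_comparison)
      show "\<forall>\<^sub>F t in at 0. norm (F t / t) \<le> 2 / a\<^sup>2 * \<bar>t\<bar>"
        using F_small by (intro always_eventually) simp
      show "((\<lambda>t. 2 / a\<^sup>2 * \<bar>t\<bar>) \<longlongrightarrow> 0) (at (0::real))"
        using \<open>a > 0\<close> by (auto intro!: tendsto_eq_intros)
    qed
    then show ?thesis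
      by (simp add: True DERIV_def F_def f_def)
  next
    case False
    have "DERIV (\<lambda>t. exp (- a / (2 * t\<^sup>2)) / a) t :> f t"
      using False \<open>a > 0\<close>
      by (auto intro!: derivative_eq_intros simp: f_def field_simps power2_eq_square power3_eq_cube)
    moreover have "\<forall>\<^sub>F x in nhds t. F x = exp (- a / (2 * x\<^sup>2)) / a"
      using t1_space_nhds[OF False] by eventually_elim (simp add: F_def)
    ultimately show ?thesis
      by (simp only: DERIV_cong_ev[OF refl _ refl])
  qed
  have "(\<integral>\<^sup>+t\<in>{0<..1}. ennreal (f t) \<partial>lborel) \<le> (\<integral>\<^sup>+t\<in>{0..1}. ennreal (f t) \<partial>lborel)"
    by (intro nn_integral_mono) (auto simp: indicator_def)
  also have "\<dots> = ennreal (F 1 - F 0)"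
  proof (rule nn_integral_FTC_Icc)
    show "f \<in> borel_measurable borel"
      unfolding f_def by measurable
    show "0 \<le> f t" if "t \<in> {0..1}" for t
      using that by (simp add: f_def)
  qed (simp_all add: deriv)
  finally show ?thesis
    by (simp add: f_def F_def)
qed

section \<open>A Hardy inequality along rays\<close>

text \<open>
  Cauchy-Schwarz on the ray through \<open>z\<close>, with the weight
  \<open>\<alpha> t = t * r\<^sup>2 * exp ((t * r)\<^sup>2 / 2)\<close> where \<open>r = cmod z\<close>, whose integral over \<open>[0, 1]\<close> is
  \<open>exp (r\<^sup>2 / 2) - 1\<close>: this costs half of the Gaussian. Substituting \<open>w = t * z\<close> and exchanging the
  integrals leaves at \<open>w\<close> the other half times an explicit integral in \<open>t\<close>, which restores
  the full Gaussian and gains the factor \<open>1 / (cmod w)\<^sup>2\<close>.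
\<close>

lemma gaussian_hardy_along_rays:
  fixes k :: "complex \<Rightarrow> ennreal"
  assumes [measurable]: "k \<in> borel_measurable borel"
  shows "(\<integral>\<^sup>+z. (ennreal (cmod z) * (\<integral>\<^sup>+t\<in>{0<..1}. k (of_real t * z) \<partial>lborel))\<^sup>2
      * ennreal (exp (- (cmod z)\<^sup>2)) \<partial>lborel)
    \<le> (\<integral>\<^sup>+w. (k w)\<^sup>2 * ennreal (exp (- (cmod w)\<^sup>2) / (cmod w)\<^sup>2) \<partial>lborel)"
proof -
  \<comment> \<open>The integrand after Cauchy-Schwarz, as a function on pairs of a ray parameter and an end point.\<close>
  define A where "A t z = (k (of_real t * z))\<^sup>2
    * ennreal (exp (- (cmod z)\<^sup>2 / 2 - (t * cmod z)\<^sup>2 / 2) / t) * indicator {0<..1} t" for t z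
  have pointwise: "(ennreal (cmod z) * (\<integral>\<^sup>+t\<in>{0<..1}. k (of_real t * z) \<partial>lborel))\<^sup>2
      * ennreal (exp (- (cmod z)\<^sup>2)) \<le> (\<integral>\<^sup>+t. A t z \<partial>lborel)" for z
  proof (cases "z = 0")
    case False
    define r where "r = cmod z"
    have "r > 0"
      using False by (simp add: r_def)
    define \<alpha> where "\<alpha> t = t * r\<^sup>2 * exp ((t * r)\<^sup>2 / 2)" for t
    have \<alpha>_pos: "\<alpha> t > 0" if "t > 0" for t
      using that \<open>r > 0\<close> by (simp add: \<alpha>_def)
    have [measurable]: "\<alpha> \<in> borel_measurable borel"
      unfolding \<alpha>_def by measurable
    define I where "I = (\<integral>\<^sup>+t. (k (of_real t * z))\<^sup>2 * ennreal (1 / \<alpha> t) * indicator {0<..1} t \<partial>lborel)"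
    define \<phi> where "\<phi> t = k (of_real t * z) * ennreal (1 / sqrt (\<alpha> t)) * indicator {0<..1} t" for t
    define \<psi> where "\<psi> t = ennreal (sqrt (\<alpha> t)) * indicator {0<..1} t" for t
    have [measurable]: "\<phi> \<in> borel_measurable borel" "\<psi> \<in> borel_measurable borel"
      unfolding \<phi>_def \<psi>_def by measurable
    have prod: "\<phi> t * \<psi> t = k (of_real t * z) * indicator {0<..1} t" for t
    proof (cases "t \<in> {0<..1}")
      case True
      then have "ennreal (1 / sqrt (\<alpha> t)) * ennreal (sqrt (\<alpha> t)) = 1"
        using \<alpha>_pos[of t] by (simp add: ennreal_mult[symmetric])
      with True show ?thesis
        by (simp add: \<phi>_def \<psi>_def mult.assoc)
    qed (simp add: \<phi>_def)
    have sq_\<phi>: "(\<phi> t)\<^sup>2 = (k (of_real t * z))\<^sup>2 * ennreal (1 / \<alpha> t) * indicator {0<..1} t" for t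
      using \<alpha>_pos[of t] by (cases "t \<in> {0<..1}") (simp_all add: \<phi>_def power_mult_distrib ennreal_power power_divide)
    have sq_\<psi>: "(\<psi> t)\<^sup>2 \<le> ennreal (\<alpha> t) * indicator {0..1} t" for t
      using \<alpha>_pos[of t] by (cases "t \<in> {0<..1}") (simp_all add: \<psi>_def ennreal_power)
    have "(\<integral>\<^sup>+t. (\<psi> t)\<^sup>2 \<partial>lborel) \<le> (\<integral>\<^sup>+t. ennreal (\<alpha> t) * indicator {0..1} t \<partial>lborel)"
      by (intro nn_integral_mono sq_\<psi>)
    also have "\<dots> = ennreal (exp ((1 * r)\<^sup>2 / 2) - exp ((0 * r)\<^sup>2 / 2))"
    proof (rule nn_integral_FTC_Icc)
      show "DERIV (\<lambda>t. exp ((t * r)\<^sup>2 / 2)) t :> \<alpha> t" for t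
        unfolding \<alpha>_def by (auto intro!: derivative_eq_intros simp: power2_eq_square)
      show "0 \<le> \<alpha> t" if "t \<in> {0..1}" for t
        using that by (simp add: \<alpha>_def)
    qed simp_all
    also have "\<dots> \<le> ennreal (exp (r\<^sup>2 / 2))"
      by (intro ennreal_leI) simp
    finally have int_\<psi>: "(\<integral>\<^sup>+t. (\<psi> t)\<^sup>2 \<partial>lborel) \<le> ennreal (exp (r\<^sup>2 / 2))" .
    have "(\<integral>\<^sup>+t. \<phi> t * \<psi> t \<partial>lborel)\<^sup>2 \<le> (\<integral>\<^sup>+t. (\<phi> t)\<^sup>2 \<partial>lborel) * (\<integral>\<^sup>+t. (\<psi> t)\<^sup>2 \<partial>lborel)"
      by (rule Cauchy_Schwarz_nn_integral) simp_all
    also have "\<dots> \<le> (\<integral>\<^sup>+t. (\<phi> t)\<^sup>2 \<partial>lborel) * ennreal (exp (r\<^sup>2 / 2))"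
      by (intro mult_left_mono int_\<psi>) simp
    finally have CS: "(\<integral>\<^sup>+t\<in>{0<..1}. k (of_real t * z) \<partial>lborel)\<^sup>2 \<le> I * ennreal (exp (r\<^sup>2 / 2))"
      by (simp only: prod sq_\<phi> I_def)
    have "(ennreal (cmod z) * (\<integral>\<^sup>+t\<in>{0<..1}. k (of_real t * z) \<partial>lborel))\<^sup>2 * ennreal (exp (- (cmod z)\<^sup>2))
        = ennreal (r\<^sup>2) * (\<integral>\<^sup>+t\<in>{0<..1}. k (of_real t * z) \<partial>lborel)\<^sup>2 * ennreal (exp (- r\<^sup>2))"
      using \<open>r > 0\<close> by (simp add: r_def power_mult_distrib ennreal_power)
    also have "\<dots> \<le> ennreal (r\<^sup>2) * (I * ennreal (exp (r\<^sup>2 / 2))) * ennreal (exp (- r\<^sup>2))"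
      by (intro mult_right_mono mult_left_mono CS) auto
    also have "\<dots> = I * (ennreal (r\<^sup>2) * ennreal (exp (r\<^sup>2 / 2)) * ennreal (exp (- r\<^sup>2)))"
      by (simp add: mult_ac)
    also have "ennreal (r\<^sup>2) * ennreal (exp (r\<^sup>2 / 2)) * ennreal (exp (- r\<^sup>2)) = ennreal (r\<^sup>2 * exp (- r\<^sup>2 / 2))"
      by (simp add: ennreal_mult[symmetric] mult.assoc exp_add[symmetric])
    also have "I * ennreal (r\<^sup>2 * exp (- r\<^sup>2 / 2)) = (\<integral>\<^sup>+t. A t z \<partial>lborel)"
      unfolding I_def
    proof (subst nn_integral_multc[symmetric], measurable, intro nn_integral_cong)
      fix t :: real
      have "1 / \<alpha> t * (r\<^sup>2 * exp (- r\<^sup>2 / 2)) = exp (- (cmod z)\<^sup>2 / 2 - (t * cmod z)\<^sup>2 / 2) / t" if "t > 0"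
      proof -
        have split: "exp (- (cmod z)\<^sup>2 / 2 - (t * cmod z)\<^sup>2 / 2) = exp (- r\<^sup>2 / 2) / exp ((t * r)\<^sup>2 / 2)"
          by (simp only: exp_diff r_def)
        show ?thesis
          using that \<open>r > 0\<close> unfolding split by (simp add: \<alpha>_def)
      qed
      then have "ennreal (1 / \<alpha> t) * ennreal (r\<^sup>2 * exp (- r\<^sup>2 / 2))
          = ennreal (exp (- (cmod z)\<^sup>2 / 2 - (t * cmod z)\<^sup>2 / 2) / t)" if "t > 0"
        using that \<alpha>_pos[OF that] by (simp add: ennreal_mult'[symmetric])
      then show "(k (of_real t * z))\<^sup>2 * ennreal (1 / \<alpha> t) * indicator {0<..1} t * ennreal (r\<^sup>2 * exp (- r\<^sup>2 / 2)) = A t z"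
        by (auto simp: A_def indicator_def mult.assoc)
    qed
    finally show ?thesis .
  qed simp
  have inner: "(\<integral>\<^sup>+z. A t z \<partial>lborel)
      = (\<integral>\<^sup>+w. (k w)\<^sup>2 * ennreal (exp (- (cmod w)\<^sup>2 / 2))
        * (ennreal (exp (- (cmod w)\<^sup>2 / (2 * t\<^sup>2)) / t ^ 3) * indicator {0<..1} t) \<partial>lborel)" for t
  proof (cases "t \<in> {0<..1}")
    case True
    \<comment> \<open>\<open>A\<close> in terms of \<open>w = t * z\<close>.\<close>
    define B where "B w = (k w)\<^sup>2 * ennreal (exp (- (cmod w)\<^sup>2 / (2 * t\<^sup>2) - (cmod w)\<^sup>2 / 2) / t)" for w
    have [measurable]: "B \<in> borel_measurable borel"
      unfolding B_def by measurable
    have "(\<integral>\<^sup>+z. A t z \<partial>lborel) = (\<integral>\<^sup>+z. B (of_real t * z) \<partial>lborel)"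
      using True by (intro nn_integral_cong) (simp add: A_def B_def norm_mult power_mult_distrib)
    also have "\<dots> = ennreal (1 / t\<^sup>2) * (\<integral>\<^sup>+w. B w \<partial>lborel)"
      using True by (intro nn_integral_lborel_scale) auto
    also have "\<dots> = (\<integral>\<^sup>+w. ennreal (1 / t\<^sup>2) * B w \<partial>lborel)"
      by (simp add: nn_integral_cmult)
    also have "\<dots> = (\<integral>\<^sup>+w. (k w)\<^sup>2 * ennreal (exp (- (cmod w)\<^sup>2 / 2))
        * (ennreal (exp (- (cmod w)\<^sup>2 / (2 * t\<^sup>2)) / t ^ 3) * indicator {0<..1} t) \<partial>lborel)"
    proof (intro nn_integral_cong)
      fix w :: complex
      have "1 / t\<^sup>2 * (exp (- (cmod w)\<^sup>2 / (2 * t\<^sup>2) - (cmod w)\<^sup>2 / 2) / t)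
          = exp (- (cmod w)\<^sup>2 / 2) * (exp (- (cmod w)\<^sup>2 / (2 * t\<^sup>2)) / t ^ 3)"
      proof -
        have split: "exp (- (cmod w)\<^sup>2 / (2 * t\<^sup>2) - (cmod w)\<^sup>2 / 2)
            = exp (- (cmod w)\<^sup>2 / 2) * exp (- (cmod w)\<^sup>2 / (2 * t\<^sup>2))"
          by (simp add: exp_add[symmetric])
        show ?thesis
          unfolding split by (simp add: power2_eq_square power3_eq_cube)
      qed
      then have "ennreal (1 / t\<^sup>2) * ennreal (exp (- (cmod w)\<^sup>2 / (2 * t\<^sup>2) - (cmod w)\<^sup>2 / 2) / t)
          = ennreal (exp (- (cmod w)\<^sup>2 / 2)) * ennreal (exp (- (cmod w)\<^sup>2 / (2 * t\<^sup>2)) / t ^ 3)"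
        using True by (simp only: ennreal_mult'[symmetric] zero_le_divide_1_iff zero_le_power2 exp_ge_zero)
      then show "ennreal (1 / t\<^sup>2) * B w = (k w)\<^sup>2 * ennreal (exp (- (cmod w)\<^sup>2 / 2))
        * (ennreal (exp (- (cmod w)\<^sup>2 / (2 * t\<^sup>2)) / t ^ 3) * indicator {0<..1} t)"
        using True by (simp add: B_def mult_ac)
    qed
    finally show ?thesis .
  qed (simp add: A_def)
  have "(\<integral>\<^sup>+z. (ennreal (cmod z) * (\<integral>\<^sup>+t\<in>{0<..1}. k (of_real t * z) \<partial>lborel))\<^sup>2
      * ennreal (exp (- (cmod z)\<^sup>2)) \<partial>lborel)
      \<le> (\<integral>\<^sup>+z. (\<integral>\<^sup>+t. A t z \<partial>lborel) \<partial>lborel)"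
    by (intro nn_integral_mono pointwise)
  also have "\<dots> = (\<integral>\<^sup>+t. (\<integral>\<^sup>+z. A t z \<partial>lborel) \<partial>lborel)"
    unfolding A_def by (rule lborel_pair.Fubini') measurable
  also have "\<dots> = (\<integral>\<^sup>+w. (\<integral>\<^sup>+t. (k w)\<^sup>2 * ennreal (exp (- (cmod w)\<^sup>2 / 2))
        * (ennreal (exp (- (cmod w)\<^sup>2 / (2 * t\<^sup>2)) / t ^ 3) * indicator {0<..1} t) \<partial>lborel) \<partial>lborel)"
    unfolding inner by (rule lborel_pair.Fubini'[symmetric]) measurable
  also have "\<dots> \<le> (\<integral>\<^sup>+w. (k w)\<^sup>2 * ennreal (exp (- (cmod w)\<^sup>2) / (cmod w)\<^sup>2) \<partial>lborel)"
  proof (rule nn_integral_mono_AE)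
    have "(\<integral>\<^sup>+t. (k w)\<^sup>2 * ennreal (exp (- (cmod w)\<^sup>2 / 2))
        * (ennreal (exp (- (cmod w)\<^sup>2 / (2 * t\<^sup>2)) / t ^ 3) * indicator {0<..1} t) \<partial>lborel)
        \<le> (k w)\<^sup>2 * ennreal (exp (- (cmod w)\<^sup>2) / (cmod w)\<^sup>2)" if "w \<noteq> 0" for w
    proof -
      have "(\<integral>\<^sup>+t. (k w)\<^sup>2 * ennreal (exp (- (cmod w)\<^sup>2 / 2))
          * (ennreal (exp (- (cmod w)\<^sup>2 / (2 * t\<^sup>2)) / t ^ 3) * indicator {0<..1} t) \<partial>lborel)
        = (k w)\<^sup>2 * ennreal (exp (- (cmod w)\<^sup>2 / 2))
          * (\<integral>\<^sup>+t\<in>{0<..1}. ennreal (exp (- (cmod w)\<^sup>2 / (2 * t\<^sup>2)) / t ^ 3) \<partial>lborel)"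
        by (rule nn_integral_cmult) measurable
      also have "\<dots> \<le> (k w)\<^sup>2 * ennreal (exp (- (cmod w)\<^sup>2 / 2))
          * ennreal (exp (- (cmod w)\<^sup>2 / 2) / (cmod w)\<^sup>2)"
        using that by (intro mult_left_mono nn_integral_inverse_cube_gaussian_le) auto
      also have "\<dots> = (k w)\<^sup>2 * ennreal (exp (- (cmod w)\<^sup>2) / (cmod w)\<^sup>2)"
      proof -
        have "exp (- (cmod w)\<^sup>2 / 2) * (exp (- (cmod w)\<^sup>2 / 2) / (cmod w)\<^sup>2) = exp (- (cmod w)\<^sup>2) / (cmod w)\<^sup>2"
          by (simp add: exp_add[symmetric])
        then show ?thesis
          by (simp only: mult.assoc ennreal_mult'[symmetric] exp_ge_zero)
      qed
      finally show ?thesis .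
    qed
    then show "AE w in lborel. (\<integral>\<^sup>+t. (k w)\<^sup>2 * ennreal (exp (- (cmod w)\<^sup>2 / 2))
        * (ennreal (exp (- (cmod w)\<^sup>2 / (2 * t\<^sup>2)) / t ^ 3) * indicator {0<..1} t) \<partial>lborel)
        \<le> (k w)\<^sup>2 * ennreal (exp (- (cmod w)\<^sup>2) / (cmod w)\<^sup>2)"
      by (rule eventually_mono[OF AE_lborel_singleton[of 0]])
  qed
  finally show ?thesis .
qed

text \<open>
  The derivative is integrated along the segment from \<open>0\<close> to \<open>z\<close>. The part inside the unit disc
  is split off because a weight like \<open>1 / (cmod w)\<^sup>2\<close> in the Hardy inequality is not integrable at
  \<open>0\<close>; that part has length at most \<open>1\<close>.
\<close>

lemma entire_increment_le_ray_integral: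
  assumes G: "G holomorphic_on UNIV" and "S \<ge> 0"
    and S: "\<And>w. cmod w < 1 \<Longrightarrow> cmod (deriv G w) \<le> S"
  shows "ennreal (cmod (G z - G 0)) \<le> ennreal S + ennreal (cmod z)
    * (\<integral>\<^sup>+t\<in>{0<..1}. ennreal (cmod (deriv G (of_real t * z))) * indicator (- ball 0 1) (of_real t * z) \<partial>lborel)"
proof (cases "z = 0")
  case False
  define r where "r = cmod z"
  have "r > 0"
    using False by (simp add: r_def)
  have G': "continuous_on UNIV (deriv G)"
    using holomorphic_deriv[OF G] by (intro holomorphic_on_imp_continuous_on) auto
  then have [measurable]: "deriv G \<in> borel_measurable borel"
    by (rule borel_measurable_continuous_onI)
  define g where "g t = z * deriv G (of_real t * z)" for t
  have g_cont: "continuous_on {0..1} g"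
    unfolding g_def by (intro continuous_intros continuous_on_compose2[OF G']) auto
  have "(g has_integral (G (of_real 1 * z) - G (of_real 0 * z))) {0..1}"
  proof (rule fundamental_theorem_of_calculus)
    fix t :: real
    have "(G has_field_derivative deriv G (of_real t * z)) (at (of_real t * z))"
      by (rule holomorphic_derivI[OF G]) auto
    then have "((\<lambda>t. G (of_real t * z)) has_vector_derivative (z * deriv G (of_real t * z))) (at t)"
      by (intro field_vector_diff_chain_at[unfolded o_def, where f = "\<lambda>t. of_real t * z"])
        (auto intro!: derivative_eq_intros)
    then show "((\<lambda>t. G (of_real t * z)) has_vector_derivative g t) (at t within {0..1})"
      unfolding g_def by (rule has_vector_derivative_at_within)
  qed simp
  then have FTC: "(g has_integral (G z - G 0)) {0..1}"
    by simp
  have int: "set_integrable lborel {0..1} g"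
    by (rule borel_integrable_atLeastAtMost'[OF g_cont])
  have "G z - G 0 = (LINT t:{0..1}|lborel. g t)"
    using set_borel_integral_eq_integral(2)[OF int] FTC by (simp add: integral_unique)
  then have "ennreal (cmod (G z - G 0)) \<le> (\<integral>\<^sup>+t. ennreal (norm (indicator {0..1} t *\<^sub>R g t)) \<partial>lborel)"
    unfolding set_lebesgue_integral_def
    using integral_norm_bound_ennreal[OF int[unfolded set_integrable_def]] by simp
  also have "\<dots> \<le> (\<integral>\<^sup>+t. ennreal (r * S) * indicator {0..1 / r} t
      + ennreal r * (ennreal (cmod (deriv G (of_real t * z))) * indicator (- ball 0 1) (of_real t * z) * indicator {0<..1} t) \<partial>lborel)"
  proof (rule nn_integral_mono)
    fix t :: real
    show "ennreal (norm (indicator {0..1} t *\<^sub>R g t)) \<le> ennreal (r * S) * indicator {0..1 / r} t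
      + ennreal r * (ennreal (cmod (deriv G (of_real t * z))) * indicator (- ball 0 1) (of_real t * z) * indicator {0<..1} t)"
    proof (cases "t \<in> {0..1}")
      case t: True
      have norm_t: "cmod (of_real t * z) = t * r"
        using t by (simp add: norm_mult r_def)
      show ?thesis
      proof (cases "t * r < 1")
        case True
        then have "t \<le> 1 / r"
          using \<open>r > 0\<close> by (simp add: field_simps)
        moreover have "r * cmod (deriv G (of_real t * z)) \<le> r * S"
          using S[of "of_real t * z"] True \<open>r > 0\<close> norm_t by (intro mult_left_mono) auto
        ultimately show ?thesis
          using t by (auto simp: g_def norm_mult r_def[symmetric] intro!: add_increasing2 ennreal_leI)
      next
        case False
        then have "of_real t * z \<in> - ball 0 1" "t > 0"
          using norm_t t by (auto simp: less_le)
        then show ?thesis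
          using t \<open>r > 0\<close>
          by (auto simp: g_def norm_mult r_def[symmetric] ennreal_mult' intro!: add_increasing)
      qed
    qed simp
  qed
  also have "\<dots> = (\<integral>\<^sup>+t. ennreal (r * S) * indicator {0..1 / r} t \<partial>lborel)
      + (\<integral>\<^sup>+t. ennreal r * (ennreal (cmod (deriv G (of_real t * z))) * indicator (- ball 0 1) (of_real t * z) * indicator {0<..1} t) \<partial>lborel)"
    by (rule nn_integral_add) measurable
  also have "(\<integral>\<^sup>+t. ennreal (r * S) * indicator {0..1 / r} t \<partial>lborel) = ennreal S"
    using \<open>r > 0\<close> \<open>S \<ge> 0\<close> by (simp add: nn_integral_cmult_indicator ennreal_mult'[symmetric])
  also have "(\<integral>\<^sup>+t. ennreal r * (ennreal (cmod (deriv G (of_real t * z))) * indicator (- ball 0 1) (of_real t * z) * indicator {0<..1} t) \<partial>lborel)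
      = ennreal r * (\<integral>\<^sup>+t\<in>{0<..1}. ennreal (cmod (deriv G (of_real t * z))) * indicator (- ball 0 1) (of_real t * z) \<partial>lborel)"
    by (rule nn_integral_cmult) measurable
  finally show ?thesis
    by (simp add: r_def)
qed simp

section \<open>From local to global\<close>

text \<open>
  The local estimate is applied at \<open>w\<close> with radius \<open>1 / cmod w\<close>, the scale on which the Gaussian
  is constant up to a factor: if \<open>cmod w \<ge> 1\<close> and \<open>z\<close> lies in that disc, then
  \<open>(cmod z)\<^sup>2 \<le> (cmod w)\<^sup>2 + 3\<close>. The powers of \<open>cmod w\<close> that are lost are compensated by the weight and by the small area, of order
  \<open>1 / (cmod z)\<^sup>2\<close>, of the set of those \<open>w\<close> whose disc contains a given \<open>z\<close>.
\<close>

lemma nn_integral_deriv_weighted_le: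
  fixes c :: real
  assumes G: "G holomorphic_on UNIV"
  shows "(\<integral>\<^sup>+w. (ennreal (cmod (deriv G w)) * indicator (- ball 0 1) w)\<^sup>2
      * ennreal (exp (- (cmod w)\<^sup>2) / (cmod w)\<^sup>2) \<partial>lborel)
    \<le> ennreal (4000000 * pi * exp 3)
      * (\<integral>\<^sup>+z. ennreal ((cmod (G z) - c)\<^sup>2 * exp (- (cmod z)\<^sup>2)) \<partial>lborel)"
proof -
  have [measurable]: "G \<in> borel_measurable borel"
    using G by (intro borel_measurable_continuous_onI holomorphic_on_imp_continuous_on)
  \<comment> \<open>Points \<open>w\<close> outside the unit disc whose disc contains \<open>z\<close> have modulus comparable to \<open>M z\<close>.\<close>
  define M where "M z = max 1 (cmod z)" for z :: complex
  have M_pos: "M z \<ge> 1" for z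
    by (simp add: M_def)
  define v where "v z = (cmod (G z) - c)\<^sup>2" for z
  have [measurable]: "M \<in> borel_measurable borel" "v \<in> borel_measurable borel"
    unfolding M_def v_def by measurable
  \<comment> \<open>A majorant on pairs that for fixed \<open>z\<close> is constant on a disc about \<open>z\<close>, so that its integral over \<open>w\<close> is an area.\<close>
  define N where "N w z = ennreal (1000000 * exp 3 * (M z)\<^sup>2 * exp (- (cmod z)\<^sup>2) * v z)
    * indicator {0<..} (2 / M z - dist z w)" for w z
  have kernel: "(cmod w)\<^sup>2 * exp (- (cmod w)\<^sup>2) \<le> 4 * exp 3 * (M z)\<^sup>2 * exp (- (cmod z)\<^sup>2)"
    and near: "dist z w < 2 / M z"
    if w: "cmod w \<ge> 1" and z: "z \<in> ball w (1 / cmod w)" for w z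
  proof -
    have d: "dist z w < 1 / cmod w"
      using z by (simp add: dist_commute)
    also have le1: "1 / cmod w \<le> 1"
      using w by (simp add: divide_le_eq_1)
    finally have d1: "dist z w < 1" .
    have tri: "cmod z \<le> cmod w + dist z w" "cmod w \<le> cmod z + dist z w"
      using norm_triangle_sub[of z w] norm_triangle_sub[of w z] by (auto simp: dist_norm norm_minus_commute)
    have wM: "cmod w \<le> 2 * M z" and Mw: "M z \<le> 2 * cmod w"
      using tri d1 w by (auto simp: M_def)
    have "1 / cmod w \<le> 2 / M z"
      using Mw M_pos[of z] order_less_le_trans[OF zero_less_one w] by (simp add: field_simps)
    with d show "dist z w < 2 / M z"
      by simp
    have "cmod z \<le> cmod w + 1 / cmod w"
      using tri d by simp
    then have "(cmod z)\<^sup>2 \<le> (cmod w + 1 / cmod w)\<^sup>2"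
      by (intro power_mono) auto
    also have "\<dots> = (cmod w)\<^sup>2 + 2 + (1 / cmod w)\<^sup>2"
      using w by (subst power2_sum) auto
    also have "(1 / cmod w)\<^sup>2 \<le> 1"
      using le1 by (simp add: abs_square_le_1)
    finally have "exp (- (cmod w)\<^sup>2) \<le> exp (3 - (cmod z)\<^sup>2)"
      by simp
    also have "\<dots> = exp 3 * exp (- (cmod z)\<^sup>2)"
      by (simp add: exp_diff exp_minus field_simps)
    finally have e: "exp (- (cmod w)\<^sup>2) \<le> exp 3 * exp (- (cmod z)\<^sup>2)" .
    have "(cmod w)\<^sup>2 \<le> (2 * M z)\<^sup>2"
      using wM by (intro power_mono) auto
    then have "(cmod w)\<^sup>2 * exp (- (cmod w)\<^sup>2) \<le> (2 * M z)\<^sup>2 * (exp 3 * exp (- (cmod z)\<^sup>2))"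
      using e by (intro mult_mono) auto
    then show "(cmod w)\<^sup>2 * exp (- (cmod w)\<^sup>2) \<le> 4 * exp 3 * (M z)\<^sup>2 * exp (- (cmod z)\<^sup>2)"
      by (simp add: power_mult_distrib mult_ac)
  qed
  have pointwise: "(ennreal (cmod (deriv G w)) * indicator (- ball 0 1) w)\<^sup>2
      * ennreal (exp (- (cmod w)\<^sup>2) / (cmod w)\<^sup>2) \<le> (\<integral>\<^sup>+z. N w z \<partial>lborel)" for w
  proof (cases "cmod w \<ge> 1")
    case w: True
    then have "cmod w > 0" by linarith
    have "(ennreal (cmod (deriv G w)) * indicator (- ball 0 1) w)\<^sup>2 * ennreal (exp (- (cmod w)\<^sup>2) / (cmod w)\<^sup>2)
        = ennreal ((cmod (deriv G w))\<^sup>2 * (exp (- (cmod w)\<^sup>2) / (cmod w)\<^sup>2))"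
      using w by (subst ennreal_mult) (auto simp: ennreal_power)
    also have "(cmod (deriv G w))\<^sup>2 * (exp (- (cmod w)\<^sup>2) / (cmod w)\<^sup>2)
        = ((cmod w)\<^sup>2 * exp (- (cmod w)\<^sup>2)) * ((1 / cmod w) ^ 4 * (cmod (deriv G w))\<^sup>2)"
      using \<open>cmod w > 0\<close> by (simp add: field_simps power2_eq_square power4_eq_xxxx)
    also have "ennreal \<dots> = ennreal ((cmod w)\<^sup>2 * exp (- (cmod w)\<^sup>2))
        * ennreal ((1 / cmod w) ^ 4 * (cmod (deriv G w))\<^sup>2)"
      by (rule ennreal_mult) auto
    also have "\<dots> \<le> ennreal ((cmod w)\<^sup>2 * exp (- (cmod w)\<^sup>2))
        * (ennreal 250000 * (\<integral>\<^sup>+z\<in>ball w (1 / cmod w). ennreal ((cmod (G z) - c)\<^sup>2) \<partial>lborel))"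
      using \<open>cmod w > 0\<close> by (intro mult_left_mono deriv_sq_le_L2_deviation[OF G]) auto
    also have "\<dots> = (\<integral>\<^sup>+z. (ennreal ((cmod w)\<^sup>2 * exp (- (cmod w)\<^sup>2)) * ennreal 250000)
        * (ennreal (v z) * indicator (ball w (1 / cmod w)) z) \<partial>lborel)"
      unfolding v_def mult.assoc[symmetric, where a = "ennreal ((cmod w)\<^sup>2 * exp (- (cmod w)\<^sup>2))"]
      by (rule nn_integral_cmult[symmetric]) measurable
    also have "\<dots> \<le> (\<integral>\<^sup>+z. N w z \<partial>lborel)"
    proof (rule nn_integral_mono)
      fix z
      show "(ennreal ((cmod w)\<^sup>2 * exp (- (cmod w)\<^sup>2)) * ennreal 250000)
          * (ennreal (v z) * indicator (ball w (1 / cmod w)) z) \<le> N w z"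
      proof (cases "z \<in> ball w (1 / cmod w)")
        case z: True
        have "((cmod w)\<^sup>2 * exp (- (cmod w)\<^sup>2)) * 250000 * v z
            \<le> (4 * exp 3 * (M z)\<^sup>2 * exp (- (cmod z)\<^sup>2)) * 250000 * v z"
          by (intro mult_right_mono kernel[OF w z]) (auto simp: v_def)
        then have "ennreal (((cmod w)\<^sup>2 * exp (- (cmod w)\<^sup>2)) * 250000 * v z)
            \<le> ennreal (1000000 * exp 3 * (M z)\<^sup>2 * exp (- (cmod z)\<^sup>2) * v z)"
          by (intro ennreal_leI) simp
        moreover have "ennreal (((cmod w)\<^sup>2 * exp (- (cmod w)\<^sup>2)) * 250000 * v z)
            = ennreal ((cmod w)\<^sup>2 * exp (- (cmod w)\<^sup>2)) * ennreal 250000 * ennreal (v z)"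
          by (subst ennreal_mult; simp add: v_def)+
        ultimately show ?thesis
          using z near[OF w z] by (simp add: N_def)
      qed simp
    qed
    finally show ?thesis .
  qed simp
  have inner: "(\<integral>\<^sup>+w. N w z \<partial>lborel) = ennreal (4000000 * pi * exp 3) * ennreal (v z * exp (- (cmod z)\<^sup>2))" for z
  proof -
    have "(\<integral>\<^sup>+w. N w z \<partial>lborel)
        = ennreal (1000000 * exp 3 * (M z)\<^sup>2 * exp (- (cmod z)\<^sup>2) * v z)
          * (\<integral>\<^sup>+w. indicator (ball z (2 / M z)) w \<partial>lborel)"
      unfolding N_def
      by (subst nn_integral_cmult[symmetric]) (auto intro!: nn_integral_cong simp: indicator_def)
    also have "\<dots> = ennreal (1000000 * exp 3 * (M z)\<^sup>2 * exp (- (cmod z)\<^sup>2) * v z) * ennreal (pi * (2 / M z)\<^sup>2)"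
      using M_pos[of z] by (simp add: emeasure_lborel_ball_complex)
    also have "\<dots> = ennreal (4000000 * pi * exp 3 * (v z * exp (- (cmod z)\<^sup>2)))"
    proof -
      have "1000000 * exp 3 * (M z)\<^sup>2 * exp (- (cmod z)\<^sup>2) * v z * (pi * (2 / M z)\<^sup>2)
          = 4000000 * pi * exp 3 * (v z * exp (- (cmod z)\<^sup>2))"
        using M_pos[of z] by (simp add: power_divide)
      moreover have "0 \<le> 1000000 * exp 3 * (M z)\<^sup>2 * exp (- (cmod z)\<^sup>2) * v z"
        by (simp add: v_def)
      ultimately show ?thesis
        by (metis ennreal_mult')
    qed
    also have "\<dots> = ennreal (4000000 * pi * exp 3) * ennreal (v z * exp (- (cmod z)\<^sup>2))"
      by (rule ennreal_mult) (auto simp: v_def)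
    finally show ?thesis .
  qed
  have "(\<integral>\<^sup>+w. (ennreal (cmod (deriv G w)) * indicator (- ball 0 1) w)\<^sup>2
      * ennreal (exp (- (cmod w)\<^sup>2) / (cmod w)\<^sup>2) \<partial>lborel)
      \<le> (\<integral>\<^sup>+w. (\<integral>\<^sup>+z. N w z \<partial>lborel) \<partial>lborel)"
    by (intro nn_integral_mono pointwise)
  also have "\<dots> = (\<integral>\<^sup>+z. (\<integral>\<^sup>+w. N w z \<partial>lborel) \<partial>lborel)"
    unfolding N_def by (rule lborel_pair.Fubini') measurable
  also have "\<dots> = ennreal (4000000 * pi * exp 3) * (\<integral>\<^sup>+z. ennreal (v z * exp (- (cmod z)\<^sup>2)) \<partial>lborel)"
    unfolding inner by (rule nn_integral_cmult) measurable
  finally show ?thesis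
    by (simp only: v_def)
qed

lemma deriv_sq_le_gaussian_deviation:
  fixes c :: real
  assumes G: "G holomorphic_on UNIV" and w: "cmod w < 1"
  shows "ennreal ((cmod (deriv G w))\<^sup>2) \<le> ennreal (250000 * exp 4)
      * (\<integral>\<^sup>+z. ennreal ((cmod (G z) - c)\<^sup>2 * exp (- (cmod z)\<^sup>2)) \<partial>lborel)"
proof -
  have [measurable]: "G \<in> borel_measurable borel"
    using G by (intro borel_measurable_continuous_onI holomorphic_on_imp_continuous_on)
  have weight: "1 \<le> exp 4 * exp (- (cmod z)\<^sup>2)" if "z \<in> ball w 1" for z
  proof -
    have "cmod z \<le> 2"
      using that w norm_triangle_sub[of z w] by (auto simp: dist_norm norm_minus_commute)
    then have "(cmod z)\<^sup>2 \<le> 2\<^sup>2"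
      by (intro power_mono) auto
    then show ?thesis
      by (simp add: exp_add[symmetric])
  qed
  have "ennreal ((cmod (deriv G w))\<^sup>2)
      \<le> ennreal 250000 * (\<integral>\<^sup>+z\<in>ball w 1. ennreal ((cmod (G z) - c)\<^sup>2) \<partial>lborel)"
    using deriv_sq_le_L2_deviation[OF G, of 1 w c] by simp
  also have "\<dots> \<le> ennreal 250000
      * (\<integral>\<^sup>+z. ennreal (exp 4) * ennreal ((cmod (G z) - c)\<^sup>2 * exp (- (cmod z)\<^sup>2)) \<partial>lborel)"
  proof (intro mult_left_mono nn_integral_mono)
    fix z
    have "(cmod (G z) - c)\<^sup>2 \<le> exp 4 * ((cmod (G z) - c)\<^sup>2 * exp (- (cmod z)\<^sup>2))" if "z \<in> ball w 1"
      using mult_left_mono[OF weight[OF that], of "(cmod (G z) - c)\<^sup>2"] by (simp add: mult_ac)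
    then show "ennreal ((cmod (G z) - c)\<^sup>2) * indicator (ball w 1) z
        \<le> ennreal (exp 4) * ennreal ((cmod (G z) - c)\<^sup>2 * exp (- (cmod z)\<^sup>2))"
      by (cases "z \<in> ball w 1") (auto simp: ennreal_mult[symmetric] intro!: ennreal_leI)
  qed simp
  also have "\<dots> = ennreal (250000 * exp 4)
      * (\<integral>\<^sup>+z. ennreal ((cmod (G z) - c)\<^sup>2 * exp (- (cmod z)\<^sup>2)) \<partial>lborel)"
    by (subst nn_integral_cmult) (simp_all add: ennreal_mult mult.assoc)
  finally show ?thesis .
qed

lemma ennreal_sum_squared_le:
  "(a + b)\<^sup>2 \<le> 2 * a\<^sup>2 + 2 * (b :: ennreal)\<^sup>2"
proof (cases a; cases b)
  fix x y assume ab: "a = ennreal x" "0 \<le> x" "b = ennreal y" "0 \<le> y"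
  have "(x + y)\<^sup>2 \<le> 2 * x\<^sup>2 + 2 * y\<^sup>2"
    using zero_le_power2[of "x - y"] by (simp add: power2_eq_square algebra_simps)
  then have "ennreal ((x + y)\<^sup>2) \<le> ennreal (2 * x\<^sup>2 + 2 * y\<^sup>2)"
    by (rule ennreal_leI)
  then show ?thesis
    using ab by (simp add: ennreal_power[symmetric] ennreal_mult')
qed (simp_all add: power2_eq_square ennreal_mult_top)

text \<open>
  The inequality for an arbitrary entire \<open>G\<close>: the increment \<open>G z - G 0\<close> is controlled by a
  bound \<open>S\<close> for the derivative on the unit disc and by its ray integral outside, and both are
  controlled by the deviation of \<open>\<bar>G\<bar>\<close> from \<open>c\<close>.
\<close>

lemma gaussian_oscillation_le_modulus_deviation:
  fixes c :: real
  assumes G: "G holomorphic_on UNIV"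
  shows "(\<integral>\<^sup>+z. ennreal ((cmod (G z - G 0))\<^sup>2 * exp (- (cmod z)\<^sup>2)) \<partial>lborel)
    \<le> ennreal (500000 * pi * exp 4 + 8000000 * pi * exp 3)
      * (\<integral>\<^sup>+z. ennreal ((cmod (G z) - c)\<^sup>2 * exp (- (cmod z)\<^sup>2)) \<partial>lborel)"
proof -
  define V where "V = (\<integral>\<^sup>+z. ennreal ((cmod (G z) - c)\<^sup>2 * exp (- (cmod z)\<^sup>2)) \<partial>lborel)"
  have "0 < 500000 * pi * exp 4 + 8000000 * pi * exp (3::real)"
    by (intro add_pos_pos) auto
  show ?thesis
  proof (cases "V = \<infinity>")
    case True
    then show ?thesis
      using \<open>0 < _\<close> by (simp add: V_def[symmetric] ennreal_mult_top del: ennreal_plus)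
  next
    case False
    then obtain e where e: "V = ennreal e" "e \<ge> 0"
      by (cases V) auto
    have "continuous_on UNIV (deriv G)"
      using holomorphic_deriv[OF G] by (intro holomorphic_on_imp_continuous_on) auto
    then have [measurable]: "deriv G \<in> borel_measurable borel"
      by (rule borel_measurable_continuous_onI)
    define S where "S = sqrt (250000 * exp 4 * e)"
    have S0: "S \<ge> 0" and S2: "S\<^sup>2 = 250000 * exp 4 * e"
      using e(2) by (auto simp: S_def)
    have S: "cmod (deriv G w) \<le> S" if "cmod w < 1" for w
    proof -
      have "ennreal ((cmod (deriv G w))\<^sup>2) \<le> ennreal (250000 * exp 4) * V"
        unfolding V_def by (rule deriv_sq_le_gaussian_deviation[OF G that])
      also have "\<dots> = ennreal (S\<^sup>2)"
        unfolding S2 e(1) using e(2) by (intro ennreal_mult[symmetric]) auto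
      finally have "(cmod (deriv G w))\<^sup>2 \<le> S\<^sup>2"
        by (simp add: ennreal_le_iff)
      then show ?thesis
        using S0 by (rule power2_le_imp_le)
    qed
    define k where "k w = ennreal (cmod (deriv G w)) * indicator (- ball 0 1) w" for w
    have [measurable]: "k \<in> borel_measurable borel"
      unfolding k_def by measurable
    define T where "T z = ennreal (cmod z) * (\<integral>\<^sup>+t\<in>{0<..1}. k (of_real t * z) \<partial>lborel)" for z
    have [measurable]: "T \<in> borel_measurable borel"
      unfolding T_def by measurable
    have "(\<integral>\<^sup>+z. ennreal ((cmod (G z - G 0))\<^sup>2 * exp (- (cmod z)\<^sup>2)) \<partial>lborel)
        \<le> (\<integral>\<^sup>+z. ennreal (2 * S\<^sup>2) * ennreal (exp (- (cmod z)\<^sup>2)) + 2 * ((T z)\<^sup>2 * ennreal (exp (- (cmod z)\<^sup>2))) \<partial>lborel)"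
    proof (rule nn_integral_mono)
      fix z
      have "ennreal ((cmod (G z - G 0))\<^sup>2 * exp (- (cmod z)\<^sup>2))
          = (ennreal (cmod (G z - G 0)))\<^sup>2 * ennreal (exp (- (cmod z)\<^sup>2))"
        by (simp add: ennreal_mult ennreal_power)
      also have "\<dots> \<le> (ennreal S + T z)\<^sup>2 * ennreal (exp (- (cmod z)\<^sup>2))"
        unfolding T_def k_def
        by (intro mult_right_mono power_mono entire_increment_le_ray_integral[OF G S0 S]) auto
      also have "\<dots> \<le> (2 * (ennreal S)\<^sup>2 + 2 * (T z)\<^sup>2) * ennreal (exp (- (cmod z)\<^sup>2))"
        by (intro mult_right_mono ennreal_sum_squared_le) auto
      also have "\<dots> = ennreal (2 * S\<^sup>2) * ennreal (exp (- (cmod z)\<^sup>2)) + 2 * ((T z)\<^sup>2 * ennreal (exp (- (cmod z)\<^sup>2)))"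
        using S0 by (simp add: ennreal_mult' ennreal_power distrib_right mult.assoc)
      finally show "ennreal ((cmod (G z - G 0))\<^sup>2 * exp (- (cmod z)\<^sup>2))
        \<le> ennreal (2 * S\<^sup>2) * ennreal (exp (- (cmod z)\<^sup>2)) + 2 * ((T z)\<^sup>2 * ennreal (exp (- (cmod z)\<^sup>2)))" .
    qed
    also have "\<dots> = (\<integral>\<^sup>+(z::complex). ennreal (2 * S\<^sup>2) * ennreal (exp (- (cmod z)\<^sup>2)) \<partial>lborel)
        + (\<integral>\<^sup>+z. 2 * ((T z)\<^sup>2 * ennreal (exp (- (cmod z)\<^sup>2))) \<partial>lborel)"
      by (rule nn_integral_add) measurable
    also have "\<dots> = ennreal (2 * S\<^sup>2) * (\<integral>\<^sup>+(z::complex). ennreal (exp (- (cmod z)\<^sup>2)) \<partial>lborel)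
        + 2 * (\<integral>\<^sup>+z. (T z)\<^sup>2 * ennreal (exp (- (cmod z)\<^sup>2)) \<partial>lborel)"
      by (subst (1 2) nn_integral_cmult) simp_all
    also have "\<dots> \<le> ennreal (2 * S\<^sup>2) * ennreal pi + 2 * (ennreal (4000000 * pi * exp 3) * V)"
    proof (intro add_mono mult_left_mono nn_integral_gaussian_le_pi)
      have "(\<integral>\<^sup>+z. (T z)\<^sup>2 * ennreal (exp (- (cmod z)\<^sup>2)) \<partial>lborel)
          \<le> (\<integral>\<^sup>+w. (k w)\<^sup>2 * ennreal (exp (- (cmod w)\<^sup>2) / (cmod w)\<^sup>2) \<partial>lborel)"
        unfolding T_def by (rule gaussian_hardy_along_rays) measurable
      also have "\<dots> \<le> ennreal (4000000 * pi * exp 3) * V"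
        unfolding k_def V_def by (rule nn_integral_deriv_weighted_le[OF G])
      finally show "(\<integral>\<^sup>+z. (T z)\<^sup>2 * ennreal (exp (- (cmod z)\<^sup>2)) \<partial>lborel) \<le> ennreal (4000000 * pi * exp 3) * V" .
    qed simp_all
    also have "\<dots> = ennreal (2 * S\<^sup>2 * pi + 2 * (4000000 * pi * exp 3 * e))"
    proof -
      have "ennreal (4000000 * pi * exp 3) * V = ennreal (4000000 * pi * exp 3 * e)"
        unfolding e(1) using e(2) by (intro ennreal_mult[symmetric]) auto
      moreover have "2 * ennreal x = ennreal (2 * x)" for x
        by (simp add: ennreal_mult')
      moreover have "ennreal (2 * S\<^sup>2) * ennreal pi = ennreal (2 * S\<^sup>2 * pi)"
        by (intro ennreal_mult[symmetric]) auto
      ultimately show ?thesis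
        using e(2) by (simp only:) (intro ennreal_plus[symmetric], auto)
    qed
    also have "2 * S\<^sup>2 * pi + 2 * (4000000 * pi * exp 3 * e) = (500000 * pi * exp 4 + 8000000 * pi * exp 3) * e"
      unfolding S2 by (simp add: algebra_simps)
    also have "ennreal \<dots> = ennreal (500000 * pi * exp 4 + 8000000 * pi * exp 3) * V"
      unfolding e(1) using \<open>0 < _\<close> e(2) by (intro ennreal_mult) auto
    finally show ?thesis
      by (simp only: V_def)
  qed
qed

section \<open>Passage to the Fock norm\<close>

lemma ennreal_sqrt_le_mult:
  assumes "x \<le> ennreal (C\<^sup>2) * y" and "C > 0"
  shows "ennreal_sqrt x \<le> ennreal C * ennreal_sqrt y"
proof (cases y)
  case (real b)
  then have x: "x \<le> ennreal (C\<^sup>2 * b)"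
    using assms by (simp add: ennreal_mult')
  then obtain a where a: "x = ennreal a" "a \<ge> 0"
    by (cases x) (auto simp: top_unique)
  have "sqrt a \<le> sqrt (C\<^sup>2 * b)"
    using x a real by (simp add: ennreal_le_iff)
  also have "\<dots> = C * sqrt b"
    using \<open>C > 0\<close> by (simp add: real_sqrt_mult)
  finally show ?thesis
    using a real \<open>C > 0\<close> by (simp add: ennreal_sqrt_def ennreal_mult'[symmetric] ennreal_leI)
qed (use \<open>C > 0\<close> in \<open>simp add: ennreal_sqrt_def ennreal_mult_top\<close>)

lemma fock_norm_eq_lborel:
  assumes [measurable]: "H \<in> borel_measurable borel"
  shows "fock_norm H = ennreal_sqrt (ennreal (1 / pi)
    * (\<integral>\<^sup>+z. ennreal ((cmod (H z))\<^sup>2 * exp (- (cmod z)\<^sup>2)) \<partial>lborel))"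
proof -
  have "(\<integral>\<^sup>+z. ennreal ((cmod (H z))\<^sup>2) \<partial>gauss_measure)
      = (\<integral>\<^sup>+z. ennreal (1 / pi) * ennreal ((cmod (H z))\<^sup>2 * exp (- (cmod z)\<^sup>2)) \<partial>lborel)"
    unfolding gauss_measure_def
    by (subst nn_integral_density) (auto intro!: nn_integral_cong simp: ennreal_mult'[symmetric] mult_ac)
  also have "\<dots> = ennreal (1 / pi) * (\<integral>\<^sup>+z. ennreal ((cmod (H z))\<^sup>2 * exp (- (cmod z)\<^sup>2)) \<partial>lborel)"
    by (rule nn_integral_cmult) measurable
  finally show ?thesis
    by (simp add: fock_norm_def)
qed

text \<open>
  The constant of the Gaussian-integral inequality: the first summand comes from the derivative on the
  unit disc, the second from the rays outside of it.
\<close>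

definition fock_constant :: real where
  "fock_constant = sqrt (500000 * pi * exp 4 + 8000000 * pi * exp 3)"

lemma fock_norm_square_le_modulus:
  assumes F: "F holomorphic_on UNIV"
  shows "fock_norm (\<lambda>z. (F z)\<^sup>2 - (F 0)\<^sup>2)
    \<le> ennreal fock_constant * (INF c::real. fock_norm (\<lambda>z. complex_of_real ((cmod (F z))\<^sup>2 - c)))"
proof -
  have [measurable]: "F \<in> borel_measurable borel"
    using F by (intro borel_measurable_continuous_onI holomorphic_on_imp_continuous_on)
  have G: "(\<lambda>z. (F z)\<^sup>2) holomorphic_on UNIV"
    by (intro holomorphic_intros F)
  have pos: "0 < 500000 * pi * exp 4 + 8000000 * pi * exp (3::real)"
    by (intro add_pos_pos) auto
  then have C: "fock_constant > 0" "fock_constant\<^sup>2 = 500000 * pi * exp 4 + 8000000 * pi * exp 3"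
    by (simp_all add: fock_constant_def)
  have bound: "fock_norm (\<lambda>z. (F z)\<^sup>2 - (F 0)\<^sup>2)
      \<le> ennreal fock_constant * fock_norm (\<lambda>z. complex_of_real ((cmod (F z))\<^sup>2 - c))" for c :: real
  proof -
    have "ennreal (1 / pi) * (\<integral>\<^sup>+z. ennreal ((cmod ((F z)\<^sup>2 - (F 0)\<^sup>2))\<^sup>2 * exp (- (cmod z)\<^sup>2)) \<partial>lborel)
        \<le> ennreal (1 / pi) * (ennreal (fock_constant\<^sup>2)
          * (\<integral>\<^sup>+z. ennreal ((cmod ((F z)\<^sup>2) - c)\<^sup>2 * exp (- (cmod z)\<^sup>2)) \<partial>lborel))"
      unfolding C(2) by (intro mult_left_mono gaussian_oscillation_le_modulus_deviation[OF G]) simp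
    also have "\<dots> = ennreal (fock_constant\<^sup>2) * (ennreal (1 / pi)
          * (\<integral>\<^sup>+z. ennreal ((cmod (complex_of_real ((cmod (F z))\<^sup>2 - c)))\<^sup>2 * exp (- (cmod z)\<^sup>2)) \<partial>lborel))"
      by (simp only: norm_of_real power2_abs norm_power mult_ac)
    finally show ?thesis
      using C(1) by (simp add: fock_norm_eq_lborel ennreal_sqrt_le_mult)
  qed
  have cancel: "ennreal fock_constant * ennreal (1 / fock_constant) = 1"
    using C(1) by (simp add: ennreal_mult[symmetric])
  have "ennreal (1 / fock_constant) * fock_norm (\<lambda>z. (F z)\<^sup>2 - (F 0)\<^sup>2)
      \<le> (INF c::real. fock_norm (\<lambda>z. complex_of_real ((cmod (F z))\<^sup>2 - c)))"
  proof (rule INF_greatest)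
    fix c :: real
    show "ennreal (1 / fock_constant) * fock_norm (\<lambda>z. (F z)\<^sup>2 - (F 0)\<^sup>2)
        \<le> fock_norm (\<lambda>z. complex_of_real ((cmod (F z))\<^sup>2 - c))"
      using mult_left_mono[OF bound[of c], of "ennreal (1 / fock_constant)"] cancel
      by (simp add: mult.assoc[symmetric] mult.commute[of "ennreal (1 / fock_constant)" "ennreal fock_constant"])
  qed
  from mult_left_mono[OF this, of "ennreal fock_constant"] show ?thesis
    using cancel by (simp add: mult.assoc[symmetric])
qed

theorem theorem1p1:
  shows "\<exists>C::real. C > 0 \<and>
    (\<forall>p :: complex poly.
       fock_norm (\<lambda>z. (poly p z)\<^sup>2 - (poly p 0)\<^sup>2)
         \<le> ennreal C * (INF c::real. fock_norm (\<lambda>z. complex_of_real ((cmod (poly p z))\<^sup>2 - c)))) \<and>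
    (\<forall>F :: complex \<Rightarrow> complex.
       F holomorphic_on UNIV \<longrightarrow> (\<lambda>z. (F z)\<^sup>2) \<in> fock_space \<longrightarrow>
       fock_norm (\<lambda>z. (F z)\<^sup>2 - (F 0)\<^sup>2)
         \<le> ennreal C * (INF c::real. fock_norm (\<lambda>z. complex_of_real ((cmod (F z))\<^sup>2 - c))))"
proof (intro exI conjI allI impI)
  show "fock_constant > 0"
    unfolding fock_constant_def by (intro real_sqrt_gt_zero add_pos_pos) auto
qed (intro fock_norm_square_le_modulus; simp add: holomorphic_intros)+

end
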